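(* Let $\mathcal{X},\mathcal{Y}$ be real Hilbert spaces, $f:\mathcal{X}\to\mathbb{R}$ convex and continuously differentiable, $A:\mathcal{X}\to\mathcal{Y}$ a continuous linear operator, $b\in\mathcal{Y}$, and suppose that the primal-dual solution set $\Omega$ of $\min\{f(x):Ax=b\}$ is nonempty. Let $t_0>0$, $\alpha>0$, $\theta>\frac1\alpha$, $0\le q<1$, $0<p<1-q$, $c>0$, and let $s\in\mathbb{R}$ satisfy $p-q-1<s<1-3q$. Let $(x(t),\lambda(t))$, $t\ge t_0$, be a solution of $$\begin{cases}\ddot{x}(t)+\frac{\alpha}{t^q}\dot{x}(t)+t^s\left(\nabla f(x(t))+A^T\lambda(t)+\frac{c}{t^p}x(t)\right)=0,\\ \dot{\lambda}(t)-t^{q+s}\left(A(x(t)+\theta t^q\dot{x}(t))-b-\frac{c}{t^p}\lambda(t)\right)=0,\end{cases}\qquad t\ge t_0,$$ and let $(x^*,\lambda^* )$ be the minimum norm element of $\Omega$. Then $$\lim_{t\to+\infty}\|(x(t),\lambda(t))-(x^*,\lambda^* )\|=0,$$ and the following hold as $t\to+\infty$. (i) If $p-q-1<s<\frac{p-3q-1}{2}$, then $$\|x(t)-x_t\|^2\le\mathcal{O}\left(\frac{1}{t^{2(1+s+q-p)}}\right),\quad \|\lambda(t)-\lambda_t\|^2\le\mathcal{O}\left(\frac{1}{t^{2(1+s+q-p)}}\right),$$ $$\|\dot{x}(t)\|^2\le\mathcal{O}\left(\frac{1}{t^{2(1+s+2q-p)}}\right),\quad \|Ax(t)-b\|\le\mathcal{O}\left(\frac{1}{t^{p}}+\frac{1}{t^{1+s+q-p}}\right).$$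 If moreover $\frac{2p-2-4q}{3}<s<\frac{p-3q-1}{2}$, then also $$\mathcal{L}_{t}(x(t),\lambda_t)-\mathcal{L}_{t}(x_t,\lambda_t)\le\mathcal{O}\left(\frac{1}{t^{4q+3s-2p+2}}\right),$$ $$\mathcal{L}(x(t),\lambda^* )-\mathcal{L}(x^*,\lambda^* )\le\mathcal{O}\left(\frac{1}{t^{p}}+\frac{1}{t^{4q+3s-2p+2}}\right),$$ $$|f(x(t))-f(x^* )|\le\mathcal{O}\left(\frac{1}{t^{p}}+\frac{1}{t^{4q+3s-2p+2}}\right).$$ (ii) If $\frac{p-3q-1}{2}\le s<1-3q$, then, with $r=\max\{q,p-q-s\}$, $$\mathcal{L}_{t}(x(t),\lambda_t)-\mathcal{L}_{t}(x_t,\lambda_t)\le\mathcal{O}\left(\frac{1}{t^{1-r}}\right),\quad \|x(t)-x_t\|^2\le\mathcal{O}\left(\frac{1}{t^{1-2q-s-r}}\right),$$ $$\|\lambda(t)-\lambda_t\|^2\le\mathcal{O}\left(\frac{1}{t^{1-2q-s-r}}\right),\quad \|\dot{x}(t)\|^2\le\mathcal{O}\left(\frac{1}{t^{1-s-r}}\right),$$ $$\mathcal{L}(x(t),\lambda^* )-\mathcal{L}(x^*,\lambda^* )\le\mathcal{O}\left(\frac{1}{t^{p}}+\frac{1}{t^{(1-2q-s-r)/2}}\right),$$ $$|f(x(t))-f(x^* )|\le\mathcal{O}\left(\frac{1}{t^{p}}+\frac{1}{t^{(1-2q-s-r)/2}}\right),\quad \|Ax(t)-b\|\le\mathcal{O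}\left(\frac{1}{t^{p}}+\frac{1}{t^{(1-2q-s-r)/2}}\right).$$
   Context: $\|(x,\lambda)\|=\sqrt{\|x\|^2+\|\lambda\|^2}$ on $\mathcal{X}\times\mathcal{Y}$; $A^T:\mathcal{Y}\to\mathcal{X}$ is the adjoint of $A$. The Lagrangian is $\mathcal{L}(x,\lambda)=f(x)+\langle\lambda,Ax-b\rangle$. The primal-dual solution set $\Omega$ is the set of saddle points of $\mathcal{L}$, i.e. of pairs $(\hat x,\hat\lambda)\in\mathcal{X}\times\mathcal{Y}$ with $\mathcal{L}(\hat x,\lambda)\le\mathcal{L}(\hat x,\hat\lambda)\le\mathcal{L}(x,\hat\lambda)$ for all $(x,\lambda)$; equivalently $\nabla f(\hat x)+A^T\hat\lambda=0$ and $A\hat x=b$. For $t\ge t_0$, $\mathcal{L}_t(x,\lambda)=\mathcal{L}(x,\lambda)+\frac{c}{2t^p}(\|x\|^2-\|\lambda\|^2)$, and $(x_t,\lambda_t)$ denotes the unique saddle point of $\mathcal{L}_t$, i.e. $\mathcal{L}_t(x_t,\lambda)\le\mathcal{L}_t(x_t,\lambda_t)\le\mathcal{L}_t(x,\lambda_t)$ for all $(x,\lambda)\in\mathcal{X}\times\mathcal{Y}$. A solution of the system is a pair $x:[t_0,+\infty)\to\mathcal{X}$ twice differentiable, $\lambda:[t_0,+\infty)\to\mathcal{Y}$ differentiable, satisfying both equations for all $t\ge t_0$. The notation $g(t)\le\mathcal{O}(h(t))$ means that there are $C>0$ and $T\ge t_0$ with $g(t)\le C\,h(t)$ for all $t\ge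 T$. *)

theory Defs
  imports "HOL-Analysis.Analysis"
begin

text \<open>A real Hilbert space is a type of sort \<open>{real_inner, complete_space}\<close>. The library norm of a
  pair is the square root of the sum of the squared norms of its components.\<close>

definition saddle_points :: "('a \<Rightarrow> 'b \<Rightarrow> real) \<Rightarrow> ('a \<times> 'b) set" where
  "saddle_points L = {(x0, l0). \<forall>x l. L x0 l \<le> L x0 l0 \<and> L x0 l0 \<le> L x l0}"

definition lagrangian ::
  "('a::real_inner \<Rightarrow> real) \<Rightarrow> ('a \<Rightarrow> 'b::real_inner) \<Rightarrow> 'b \<Rightarrow> 'a \<Rightarrow> 'b \<Rightarrow> real" where
  "lagrangian f A b x l = f x + inner l (A x - b)"

definition reg_lagrangian ::
  "('a::real_inner \<Rightarrow> real) \<Rightarrow> ('a \<Rightarrow> 'b::real_inner) \<Rightarrow> 'b \<Rightarrow> real \<Rightarrow> real \<Rightarrow> real \<Rightarrow> 'a \<Rightarrow> 'b \<Rightarrow> real" where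
  "reg_lagrangian f A b c p t x l =
     lagrangian f A b x l + c / (2 * t powr p) * ((norm x)\<^sup>2 - (norm l)\<^sup>2)"

text \<open>For convex continuously differentiable \<open>f\<close>, bounded linear \<open>A\<close> and \<open>c, t > 0\<close>, the function
  \<open>reg_lagrangian f A b c p t\<close> is strongly convex-strongly concave, so on Hilbert spaces the
  description below determines an element.\<close>

definition the_saddle_point :: "('a \<Rightarrow> 'b \<Rightarrow> real) \<Rightarrow> 'a \<times> 'b" where
  "the_saddle_point L = (THE z. z \<in> saddle_points L)"

text \<open>Well-defined for nonempty closed convex subsets of a Hilbert space.\<close>

definition min_norm_element :: "'a::real_normed_vector set \<Rightarrow> 'a" where
  "min_norm_element S = (THE z. z \<in> S \<and> (\<forall>w\<in>S. norm z \<le> norm w))"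

text \<open>The one-sided relation \<open>g(t) \<le> O(h(t))\<close>, with no absolute value on \<open>g\<close>.\<close>

definition le_bigO :: "real \<Rightarrow> (real \<Rightarrow> real) \<Rightarrow> (real \<Rightarrow> real) \<Rightarrow> bool" where
  "le_bigO t0 g h \<longleftrightarrow> (\<exists>C>0. \<exists>T\<ge>t0. \<forall>t\<ge>T. g t \<le> C * h t)"

text \<open>A solution \<open>(x, l)\<close> of the primal-dual system on \<open>[t0, \<infinity>)\<close>, together with the derivatives
  \<open>x'\<close>, \<open>x''\<close> and \<open>l'\<close> (one-sided at \<open>t0\<close>); \<open>G\<close> is the gradient of the objective.
  The library's \<open>adjoint\<close> is a choice of an operator \<open>B\<close> with
  \<open>inner (A x) y = inner x (B y)\<close> for all \<open>x\<close> and \<open>y\<close>; it exists for bounded linear \<open>A\<close> on a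
  Hilbert space by the Riesz representation theorem, and is unique.\<close>

definition primal_dual_solution ::
  "('a::real_inner \<Rightarrow> 'a) \<Rightarrow> ('a \<Rightarrow> 'b::real_inner) \<Rightarrow> 'b \<Rightarrow>
   real \<Rightarrow> real \<Rightarrow> real \<Rightarrow> real \<Rightarrow> real \<Rightarrow> real \<Rightarrow> real \<Rightarrow>
   (real \<Rightarrow> 'a) \<Rightarrow> (real \<Rightarrow> 'a) \<Rightarrow> (real \<Rightarrow> 'a) \<Rightarrow> (real \<Rightarrow> 'b) \<Rightarrow> (real \<Rightarrow> 'b) \<Rightarrow> bool" where
  "primal_dual_solution G A b t0 \<alpha> \<theta> q p s c x x' x'' l l' \<longleftrightarrow>
     (\<forall>t\<ge>t0.
        (x has_vector_derivative x' t) (at t within {t0..}) \<and>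
        (x' has_vector_derivative x'' t) (at t within {t0..}) \<and>
        (l has_vector_derivative l' t) (at t within {t0..}) \<and>
        x'' t + (\<alpha> / t powr q) *\<^sub>R x' t
          + (t powr s) *\<^sub>R (G (x t) + adjoint A (l t) + (c / t powr p) *\<^sub>R x t) = 0 \<and>
        l' t - (t powr (q + s)) *\<^sub>R
          (A (x t + (\<theta> * t powr q) *\<^sub>R x' t) - b - (c / t powr p) *\<^sub>R l t) = 0)"

end

theory Submission
  imports Defs
begin

text \<open>Write \<open>z t = (x\<^sub>t, l\<^sub>t)\<close> for the saddle point of the regularized Lagrangian. It solves a
  Tikhonov-regularized monotone inclusion with parameter \<open>c / t powr p\<close>, hence converges to the
  minimum norm solution and is Lipschitz with constant \<open>O(1 / t)\<close>. With \<open>a = 1 / \<theta> < \<alpha>\<close>,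
  \<open>u = x t - x\<^sub>t\<close>, \<open>v = l t - l\<^sub>t\<close> and \<open>w = a u + t powr q x' t\<close>, consider the energy
  \<open>t powr (2 q + s) gap t + |w|\<^sup>2 / 2 + a (\<alpha> - a) |u|\<^sup>2 / 2 + a |v|\<^sup>2 / 2\<close>, where \<open>gap\<close> is the
  regularized Lagrangian gap in the primal variable. Its upper right derivative \<open>D\<close> satisfies
  \<open>D \<le> - \<mu> t powr (- r) energy + K t powr (- k - r)\<close> for large \<open>t\<close>: the first term comes from
  strong convexity and friction, the second from the drift of \<open>z\<close>. For \<open>r < 1\<close> this forces
  \<open>energy = O(t powr (- k))\<close>. The two regimes of the theorem take \<open>r = p - q - s\<close>,
  \<open>k = 2 (1 + s + q - p)\<close> and \<open>r = max q (p - q - s)\<close>, \<open>k = 1 - 2 q - s - r\<close>.\<close>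

section \<open>Strongly convex minimization and adjoints\<close>

text \<open>Only continuity of the gradient is assumed, so no derivative of \<open>z\<close> is
  available and the energy cannot be differentiated along it. At each time the saddle point is
  frozen instead: the energy is dominated at all later times by a differentiable function that
  touches it there, and a barrier argument asks only for the derivative of this majorant at the
  point of contact.

  The weights of the energy are forced by cancellation. Differentiating
  \<open>|w|\<^sup>2 / 2\<close> along the flow produces the Lagrangian gradient tested with
  \<open>x' t\<close>, an inner product of \<open>u\<close> and \<open>x' t\<close>, and a
  primal-dual coupling; the weights \<open>t powr (2 q + s)\<close>, \<open>a (\<alpha> - a)\<close>
  and \<open>a\<close> remove exactly these three. The assumption
  \<open>\<theta> > 1 / \<alpha>\<close> keeps \<open>\<alpha> - a\<close> positive, both as a
  weight and as the remaining friction.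

  Comparing what is dissipated with its weight in the energy gives the factor
  \<open>t powr (- q)\<close> for the gap and the velocity, and
  \<open>t powr (- (p - q - s))\<close> for \<open>u\<close> and \<open>v\<close>; hence
  \<open>r\<close> must dominate both \<open>q\<close> and \<open>p - q - s\<close>.\<close>

lemma strongly_convex_minimizer:
  fixes g :: "'a::{real_inner,complete_space} \<Rightarrow> real"
  assumes cont: "continuous_on UNIV g" and m: "m > 0"
    and mid: "\<And>x y. g ((1/2) *\<^sub>R (x + y)) \<le> (g x + g y) / 2 - m * (norm (x - y))\<^sup>2"
    and lower: "\<And>x. B \<le> g x"
  shows "\<exists>x. \<forall>y. g x \<le> g y"
proof -
  define I where "I = Inf (range g)"
  have bdd: "bdd_below (range g)" using lower by (auto intro!: bdd_belowI[of _ B])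
  have I_le: "I \<le> g y" for y unfolding I_def by (rule cInf_lower[OF _ bdd]) auto
  have "\<exists>x. g x < I + inverse (real (Suc n))" for n
    using cInf_lessD[of "range g" "I + inverse (real (Suc n))"] by (auto simp: I_def)
  then obtain X where X: "\<And>n. g (X n) < I + inverse (real (Suc n))" by metis
  \<comment> \<open>Both values are within \<open>inverse (real (Suc N))\<close> of the infimum and
    the midpoint value is not below it, so the midpoint defect bounds the distance. Completeness
    thereby takes the place of weak compactness.\<close>
  have close: "m * (norm (X i - X j))\<^sup>2 \<le> inverse (real (Suc N))" if "i \<ge> N" "j \<ge> N" for i j N
  proof -
    have "inverse (real (Suc i)) \<le> inverse (real (Suc N))" "inverse (real (Suc j)) \<le> inverse (real (Suc N))"
      using that by (auto intro: le_imp_inverse_le)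
    then have "g (X i) \<le> I + inverse (real (Suc N))" "g (X j) \<le> I + inverse (real (Suc N))"
      using X[of i] X[of j] by linarith+
    moreover have "u \<le> I + d \<Longrightarrow> v \<le> I + d \<Longrightarrow> w \<le> (u + v) / 2 - k \<Longrightarrow> I \<le> w \<Longrightarrow> k \<le> d" for u v w k d :: real
      by (simp add: field_simps)
    ultimately show ?thesis using mid[of "X i" "X j"] I_le[of "(1/2) *\<^sub>R (X i + X j)"] by blast
  qed
  have "Cauchy X"
  proof (rule CauchyI)
    fix e :: real assume "e > 0"
    then have "m * e\<^sup>2 > 0" using m by simp
    then obtain N where N: "inverse (real (Suc N)) < m * e\<^sup>2" using reals_Archimedean by blast
    have "norm (X i - X j) < e" if "i \<ge> N" "j \<ge> N" for i j
    proof -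
      have "m * (norm (X i - X j))\<^sup>2 < m * e\<^sup>2" using close[OF that] N by linarith
      then have "(norm (X i - X j))\<^sup>2 < e\<^sup>2" using m by simp
      then show ?thesis using \<open>e > 0\<close> by (simp add: power_less_imp_less_base)
    qed
    then show "\<exists>M. \<forall>i\<ge>M. \<forall>j\<ge>M. norm (X i - X j) < e" by blast
  qed
  then obtain z where z: "X \<longlonglongrightarrow> z" using Cauchy_convergent_iff convergent_def by blast
  have "(\<lambda>n. g (X n)) \<longlonglongrightarrow> g z"
    using cont z continuous_on_tendsto_compose[of UNIV g X z sequentially] by auto
  moreover have "(\<lambda>n. I + inverse (real (Suc n))) \<longlonglongrightarrow> I"
    using tendsto_add[OF tendsto_const LIMSEQ_inverse_real_of_nat, of I] by simp
  ultimately have "g z \<le> I"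
    by (rule LIMSEQ_le) (use X less_imp_le in blast)
  then show ?thesis using I_le order_trans by blast
qed

text \<open>\<open>adjoint\<close> is a choice operator, so the identity rests on existence. The
  Riesz vector is found as the minimizer of \<open>(norm x)\<^sup>2 - 2 * inner (A x) y\<close>,
  whose first-order condition is the representation.\<close>

lemma adjoint_hilbert:
  fixes A :: "'a::{real_inner,complete_space} \<Rightarrow> 'b::real_inner"
  assumes A: "bounded_linear A"
  shows "inner (A x) y = inner x (adjoint A y)"
proof -
  interpret A: bounded_linear A by (rule A)
  have "\<exists>z. \<forall>x. inner (A x) y = inner x z" for y
  proof -
    define g where "g x = (norm x)\<^sup>2 - 2 * inner (A x) y" for x
    obtain K where K: "\<And>x. norm (A x) \<le> norm x * K" using A.bounded by blast
    have "continuous_on UNIV g"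
      unfolding g_def by (intro continuous_intros linear_continuous_on A)
    moreover have "g ((1/2) *\<^sub>R (u + v)) \<le> (g u + g v) / 2 - (1/4) * (norm (u - v))\<^sup>2" for u v
      unfolding g_def power2_norm_eq_inner
      by (simp add: A.add A.scaleR inner_simps inner_commute field_simps)
    moreover have "- (K * norm y)\<^sup>2 \<le> g u" for u
    proof -
      have "inner (A u) y \<le> norm u * (K * norm y)"
        using norm_cauchy_schwarz[of "A u" y] mult_right_mono[OF K[of u] norm_ge_zero[of y]] by (simp add: mult.assoc)
      then show ?thesis unfolding g_def
        using zero_le_power2[of "norm u - K * norm y"] by (simp add: power2_diff)
    qed
    ultimately have "\<exists>z. \<forall>u. g z \<le> g u"
      by (intro strongly_convex_minimizer[of g "1/4" "- (K * norm y)\<^sup>2"]) auto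
    then obtain z where z: "\<And>u. g z \<le> g u" by blast
    have "(g has_derivative (\<lambda>h. 2 * inner h z - 2 * inner (A h) y)) (at z)"
      unfolding g_def power2_norm_eq_inner
      by (auto intro!: derivative_eq_intros A.has_derivative simp: inner_commute)
    then have "(\<lambda>h. 2 * inner h z - 2 * inner (A h) y) = (\<lambda>h. 0)"
      by (rule differential_zero_maxmin[OF UNIV_I open_UNIV]) (use z in auto)
    then have "\<forall>h. inner (A h) y = inner h z" by (metis (no_types, lifting) diff_eq_diff_eq diff_self mult_cancel_left zero_neq_numeral)
    then show ?thesis by blast
  qed
  then obtain B where "\<forall>y x. inner (A x) y = inner x (B y)" by metis
  then have "\<forall>x y. inner (A x) y = inner x (adjoint A y)"
    unfolding adjoint_def by (intro someI_ex[where P="\<lambda>f'. \<forall>x y. inner (A x) y = inner x (f' y)"]) blast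
  then show ?thesis by blast
qed

text \<open>Restriction to the line through \<open>x\<close> and \<open>y\<close> reduces this to
  the tangent inequality in one real variable, taken at parameter 0.\<close>

lemma convex_gderiv_above_tangent:
  fixes f :: "'a::real_inner \<Rightarrow> real"
  assumes f: "convex_on UNIV f" and d: "GDERIV f x :> d"
  shows "f x + inner d (y - x) \<le> f y"
proof -
  define g where "g r = f (x + r *\<^sub>R (y - x))" for r
  have "convex_on UNIV g"
  proof (rule convex_onI)
    fix t u v :: real assume t: "0 < t" "t < 1"
    have "x + ((1 - t) *\<^sub>R u + t *\<^sub>R v) *\<^sub>R (y - x) =
      (1 - t) *\<^sub>R (x + u *\<^sub>R (y - x)) + t *\<^sub>R (x + v *\<^sub>R (y - x))"
      by (simp add: algebra_simps)
    then show "g ((1 - t) *\<^sub>R u + t *\<^sub>R v) \<le> (1 - t) * g u + t * g v"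
      unfolding g_def using convex_onD[OF f, of t] t by simp
  qed auto
  moreover have "(g has_real_derivative inner d (y - x)) (at 0)"
  proof -
    have "(f has_derivative (\<lambda>h. inner h d)) (at (x + 0 *\<^sub>R (y - x)))"
      using d by (simp add: gderiv_def)
    then have "((\<lambda>r. f (x + r *\<^sub>R (y - x))) has_derivative (\<lambda>h. inner (h *\<^sub>R (y - x)) d)) (at 0)"
      by (rule has_derivative_compose[rotated]) (auto intro!: derivative_eq_intros)
    moreover have "(\<lambda>h. inner (h *\<^sub>R (y - x)) d) = (*) (inner d (y - x))"
      by (auto simp: inner_commute)
    ultimately show ?thesis unfolding g_def has_field_derivative_def by metis
  qed
  ultimately have "g 1 - g 0 \<ge> inner d (y - x) * (1 - 0)"
    by (intro convex_on_imp_above_tangent[of UNIV]) auto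
  then show ?thesis by (simp add: g_def)
qed

section \<open>Regularized saddle points\<close>

text \<open>\<open>z\<close> belongs to the larger parameter \<open>e\<close>, hence to the earlier
  time. Expanding the hypothesis symmetrically, as \<open>(e + d) / 2\<close> times the squared
  distance plus \<open>(e - d) / 2\<close> times the difference of squared norms, gives the first
  claim. Writing \<open>e *\<^sub>R z - d *\<^sub>R w\<close> as
  \<open>e *\<^sub>R (z - w) + (e - d) *\<^sub>R w\<close> and applying Cauchy-Schwarz gives the
  second.\<close>

lemma tikhonov_pair:
  fixes z w :: "'a::real_inner"
  assumes mono: "inner (z - w) (e *\<^sub>R z - d *\<^sub>R w) \<le> 0" and d: "0 < d" "d \<le> e"
  shows tikhonov_pair_norm: "(norm (z - w))\<^sup>2 \<le> (norm w)\<^sup>2 - (norm z)\<^sup>2"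
    and tikhonov_pair_lipschitz: "norm (z - w) \<le> (e - d) / e * norm w"
proof -
  have "(e + d) * (norm (z - w))\<^sup>2 \<le> (e - d) * ((norm w)\<^sup>2 - (norm z)\<^sup>2)"
    using mono unfolding power2_norm_eq_inner by (simp add: inner_simps inner_commute algebra_simps)
  moreover have nn: "0 \<le> (e - d) * (norm w)\<^sup>2" using d by simp
  \<comment> \<open>Enlarging the factor to \<open>e + d\<close> requires that the norm does not
    drop from \<open>z\<close> to \<open>w\<close>. For \<open>d < e\<close> this is read off from
    the inequality just derived; for \<open>e = d\<close> the two points coincide.\<close>
  moreover have "(e - d) * ((norm w)\<^sup>2 - (norm z)\<^sup>2) \<le> (e + d) * ((norm w)\<^sup>2 - (norm z)\<^sup>2)"
  proof (rule mult_right_mono)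
    have "0 \<le> (e + d) * (norm (z - w))\<^sup>2" using d by simp
    then have "0 \<le> (e - d) * ((norm w)\<^sup>2 - (norm z)\<^sup>2)" using calculation by linarith
    then have "e = d \<or> 0 \<le> (norm w)\<^sup>2 - (norm z)\<^sup>2" using d by (auto simp: zero_le_mult_iff)
    moreover have "z = w" if "e = d"
    proof -
      have "d * (norm (z - w))\<^sup>2 \<le> 0" using mono that
        unfolding power2_norm_eq_inner by (simp add: scaleR_right_diff_distrib[symmetric])
      then show ?thesis using d by (simp add: mult_le_0_iff not_le[symmetric])
    qed
    ultimately show "0 \<le> (norm w)\<^sup>2 - (norm z)\<^sup>2" by auto
  qed (use d in auto)
  ultimately have "(e + d) * (norm (z - w))\<^sup>2 \<le> (e + d) * ((norm w)\<^sup>2 - (norm z)\<^sup>2)" by linarith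
  then show "(norm (z - w))\<^sup>2 \<le> (norm w)\<^sup>2 - (norm z)\<^sup>2" using d by (simp add: mult_le_cancel_left)
  have "e * (norm (z - w))\<^sup>2 \<le> (e - d) * (- inner (z - w) w)"
    using mono unfolding power2_norm_eq_inner by (simp add: inner_simps inner_commute algebra_simps)
  also have "\<dots> \<le> (e - d) * (norm (z - w) * norm w)"
    using Cauchy_Schwarz_ineq2[of "z - w" w] d by (intro mult_left_mono) auto
  finally have "norm (z - w) * (e * norm (z - w)) \<le> norm (z - w) * ((e - d) * norm w)"
    by (simp add: power2_eq_square mult_ac)
  then have "norm (z - w) = 0 \<or> e * norm (z - w) \<le> (e - d) * norm w"
    by (auto simp: mult_le_cancel_left)
  moreover have "0 \<le> (e - d) / e * norm w" using d by auto
  ultimately show "norm (z - w) \<le> (e - d) / e * norm w" using d by (auto simp: field_simps)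
qed

section \<open>The stationarity system of the regularized Lagrangian\<close>

locale convex_saddle =
  fixes f :: "'a::{real_inner,complete_space} \<Rightarrow> real"
    and gradf :: "'a \<Rightarrow> 'a"
    and A :: "'a \<Rightarrow> 'b::{real_inner,complete_space}"
    and b :: 'b
  assumes convex: "convex_on UNIV f"
    and grad: "GDERIV f y :> gradf y"
    and grad_cont: "continuous_on UNIV gradf"
    and A: "bounded_linear A"
begin

lemmas A_add = linear_add[OF bounded_linear.linear[OF A]]
  and A_diff = linear_diff[OF bounded_linear.linear[OF A]]
  and A_scaleR = linear_cmul[OF bounded_linear.linear[OF A]]
  and A_has_derivative = bounded_linear.has_derivative[OF A]
  and A_tendsto = bounded_linear.tendsto[OF A]
  and A_continuous_on = bounded_linear.continuous_on[OF A]

definition reg :: "real \<Rightarrow> 'a \<Rightarrow> 'b \<Rightarrow> real" where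
  "reg e x l = f x + inner l (A x - b) + e / 2 * ((norm x)\<^sup>2 - (norm l)\<^sup>2)"

text \<open>Testing the stationarity equation in \<open>x\<close> against all \<open>h\<close> keeps the adjoint, whose continuity
  would otherwise be needed, out of the limit arguments.\<close>

definition kkt :: "real \<Rightarrow> 'a \<times> 'b \<Rightarrow> bool" where
  "kkt e = (\<lambda>(x, l). (\<forall>h. inner h (gradf x) + inner (A h) l + e * inner h x = 0) \<and> A x - b = e *\<^sub>R l)"

lemma f_tangent: "f x + inner (gradf x) (y - x) \<le> f y"
  by (rule convex_gderiv_above_tangent[OF convex grad])

lemma f_has_derivative: "(f has_derivative (\<lambda>h. inner h (gradf x))) (at x)"
  using grad[of x] by (simp add: gderiv_def)

lemma f_has_derivative_compose [derivative_intros]: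
  "(g has_derivative g') (at t within S) \<Longrightarrow>
    ((\<lambda>t. f (g t)) has_derivative (\<lambda>h. inner (g' h) (gradf (g t)))) (at t within S)"
  by (rule has_derivative_compose[OF _ f_has_derivative])

lemma f_continuous: "continuous_on UNIV f"
  by (intro continuous_at_imp_continuous_on ballI has_derivative_continuous[OF f_has_derivative])

lemma reg_tangent:
  "reg e x l + (inner (y - x) (gradf x) + inner (A (y - x)) l + e * inner (y - x) x)
    + e / 2 * (norm (y - x))\<^sup>2 \<le> reg e y l"
  using f_tangent[of x y] unfolding reg_def power2_norm_eq_inner
  by (simp add: A_diff inner_simps inner_commute algebra_simps)

lemma reg_dual:
  "reg e x m = reg e x l + inner (m - l) (A x - b - e *\<^sub>R l) - e / 2 * (norm (m - l))\<^sup>2"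
  unfolding reg_def power2_norm_eq_inner
  by (simp add: inner_simps inner_commute field_simps)

lemma reg_has_derivative:
  "((\<lambda>y. reg e y l) has_derivative (\<lambda>h. inner h (gradf x) + inner (A h) l + e * inner h x)) (at x)"
  unfolding reg_def power2_norm_eq_inner
  by (auto intro!: derivative_eq_intros A_has_derivative simp: inner_commute)

text \<open>Admitting \<open>e = 0\<close> puts the solution set and the regularized saddle points
  under one system. Stationarity suffices because \<open>reg\<close> lies above its tangents in the
  primal variable and is an explicit concave quadratic in the dual one.\<close>

lemma saddle_points_reg_iff:
  assumes "e \<ge> 0"
  shows "z \<in> saddle_points (reg e) \<longleftrightarrow> kkt e z"
proof (cases z)
  case (Pair x l)
  show ?thesis
  proof
    assume "z \<in> saddle_points (reg e)"
    then have s: "reg e x m \<le> reg e x l" "reg e x l \<le> reg e y l" for y m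
      by (auto simp: saddle_points_def Pair)
    have "(\<lambda>h. inner h (gradf x) + inner (A h) l + e * inner h x) = (\<lambda>h. 0)"
      by (rule differential_zero_maxmin[OF UNIV_I open_UNIV reg_has_derivative]) (use s in auto)
    then have 1: "\<forall>h. inner h (gradf x) + inner (A h) l + e * inner h x = 0" by meson
    have "((\<lambda>m. reg e x m) has_derivative (\<lambda>h. inner h (A x - b - e *\<^sub>R l))) (at l)"
      unfolding reg_def power2_norm_eq_inner
      by (auto intro!: derivative_eq_intros simp: inner_commute inner_simps)
    then have "(\<lambda>h. inner h (A x - b - e *\<^sub>R l)) = (\<lambda>h. 0)"
      by (rule differential_zero_maxmin[OF UNIV_I open_UNIV]) (use s in auto)
    then have "inner (A x - b - e *\<^sub>R l) (A x - b - e *\<^sub>R l) = 0" by meson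
    then show "kkt e z" using 1 by (simp add: kkt_def Pair)
  next
    assume "kkt e z"
    then have k: "\<And>h. inner h (gradf x) + inner (A h) l + e * inner h x = 0" "A x - b = e *\<^sub>R l"
      by (auto simp: kkt_def Pair)
    have "reg e x m \<le> reg e x l" for m
      using reg_dual[of e x m l] k(2) assms by simp
    moreover have "reg e x l \<le> reg e y l" for y
    proof -
      have "0 \<le> e / 2 * (norm (y - x))\<^sup>2" using assms by simp
      then show ?thesis using reg_tangent[of e x l y] k(1)[of "y - x"] by linarith
    qed
    ultimately show "z \<in> saddle_points (reg e)" by (simp add: saddle_points_def Pair)
  qed
qed

text \<open>The coupling through \<open>A\<close> is skew: the constraint equations turn its
  contribution into the dual part of the claimed inner product. What remains is monotonicity of the
  gradient, the sum of two tangent inequalities.\<close>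

lemma kkt_monotone:
  assumes "kkt e z" "kkt d w"
  shows "inner (z - w) (e *\<^sub>R z - d *\<^sub>R w) \<le> 0"
proof (cases z; cases w)
  fix x l y m assume zw: "z = (x, l)" "w = (y, m)"
  have k: "inner (x - y) (gradf x) + inner (A (x - y)) l + e * inner (x - y) x = 0"
    "inner (x - y) (gradf y) + inner (A (x - y)) m + d * inner (x - y) y = 0"
    "A x - b = e *\<^sub>R l" "A y - b = d *\<^sub>R m"
    using assms by (auto simp: kkt_def zw)
  have "A (x - y) = e *\<^sub>R l - d *\<^sub>R m" using k(3,4) by (simp add: A_diff algebra_simps)
  then have "inner (A (x - y)) l - inner (A (x - y)) m = inner (l - m) (e *\<^sub>R l - d *\<^sub>R m)"
    by (metis inner_commute inner_diff_right)
  moreover have "0 \<le> inner (x - y) (gradf x) - inner (x - y) (gradf y)"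
    using f_tangent[of x y] f_tangent[of y x] by (simp add: inner_simps inner_commute)
  ultimately show ?thesis using k(1,2) by (simp add: zw inner_simps algebra_simps)
qed

lemma kkt_unique:
  assumes "kkt e z" "kkt e w" "e > 0"
  shows "z = w"
  using tikhonov_pair_lipschitz[OF kkt_monotone[OF assms(1,2)]] assms(3) by simp

text \<open>The second equation determines the multiplier as
  \<open>(1 / e) *\<^sub>R (A x - b)\<close>. Substituting it leaves the optimality condition of the
  penalized function \<open>g\<close>, which is strongly convex because of its last term
  alone.\<close>

lemma kkt_exists:
  assumes e: "e > 0"
  obtains z where "kkt e z"
proof -
  define g where "g x = f x + (norm (A x - b))\<^sup>2 / (2 * e) + e / 2 * (norm x)\<^sup>2" for x
  have "continuous_on UNIV g"
    unfolding g_def by (intro continuous_intros f_continuous linear_continuous_on A) (use e in auto)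
  moreover have "g ((1/2) *\<^sub>R (u + v)) \<le> (g u + g v) / 2 - (e / 8) * (norm (u - v))\<^sup>2" for u v
  proof -
    have F: "f ((1/2) *\<^sub>R (u + v)) \<le> (f u + f v) / 2"
      using convex_onD[OF convex, of "1/2" u v] by (simp add: scaleR_right_distrib)
    have mid: "A ((1/2) *\<^sub>R (u + v)) - b = (1/2) *\<^sub>R ((A u - b) + (A v - b))"
      by (simp add: A_scaleR A_add algebra_simps flip: scaleR_left_distrib)
    have "(norm ((1/2) *\<^sub>R (r + t)))\<^sup>2 \<le> ((norm r)\<^sup>2 + (norm t)\<^sup>2) / 2" for r t :: 'b
      using inner_ge_zero[of "r - t"] unfolding power2_norm_eq_inner
      by (simp add: inner_simps inner_commute field_simps)
    then have "(norm ((1/2) *\<^sub>R ((A u - b) + (A v - b))))\<^sup>2 / (2 * e)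
        \<le> ((norm (A u - b))\<^sup>2 + (norm (A v - b))\<^sup>2) / 2 / (2 * e)"
      using e by (intro divide_right_mono) auto
    then have N: "(norm ((1/2) *\<^sub>R ((A u - b) + (A v - b))))\<^sup>2 / (2 * e)
        \<le> ((norm (A u - b))\<^sup>2 / (2 * e) + (norm (A v - b))\<^sup>2 / (2 * e)) / 2"
      by (simp only: add_divide_distrib divide_divide_eq_left mult.commute)
    have X: "e / 2 * (norm ((1/2) *\<^sub>R (u + v)))\<^sup>2
       = (e / 2 * (norm u)\<^sup>2 + e / 2 * (norm v)\<^sup>2) / 2 - (e / 8) * (norm (u - v))\<^sup>2"
      unfolding power2_norm_eq_inner by (simp add: inner_simps inner_commute field_simps)
    have "F \<le> (a1 + a2) / 2 \<Longrightarrow> N \<le> (b1 + b2) / 2 \<Longrightarrow> X = (c1 + c2) / 2 - Y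
      \<Longrightarrow> F + N + X \<le> (a1 + b1 + c1 + (a2 + b2 + c2)) / 2 - Y" for F N X Y a1 a2 b1 b2 c1 c2 :: real
      by (simp add: field_simps)
    from this[OF F N X] show ?thesis unfolding g_def mid .
  qed
  \<comment> \<open>The tangent of \<open>f\<close> at 0 decreases at most linearly, and completing
    the square absorbs it into the quadratic term.\<close>
  moreover have "f 0 - (norm (gradf 0))\<^sup>2 / (2 * e) \<le> g u" for u
  proof -
    have "f u \<ge> f 0 - norm (gradf 0) * norm u"
      using f_tangent[of 0 u] Cauchy_Schwarz_ineq2[of "gradf 0" u] by simp
    moreover have "norm (gradf 0) * norm u \<le> (norm (gradf 0))\<^sup>2 / (2 * e) + e / 2 * (norm u)\<^sup>2"
      using zero_le_power2[of "norm (gradf 0) - e * norm u"] e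
      by (simp add: power2_diff field_simps power2_eq_square)
    moreover have "0 \<le> (norm (A u - b))\<^sup>2 / (2 * e)" using e by simp
    ultimately show ?thesis unfolding g_def by linarith
  qed
  ultimately have "\<exists>x. \<forall>y. g x \<le> g y"
    by (intro strongly_convex_minimizer[of g "e / 8" "f 0 - (norm (gradf 0))\<^sup>2 / (2 * e)"]) (use e in auto)
  then obtain x where x: "\<And>y. g x \<le> g y" by blast
  have "(g has_derivative (\<lambda>h. inner h (gradf x) + inner (A h) ((1 / e) *\<^sub>R (A x - b)) + e * inner h x)) (at x)"
  proof -
    have g_eq: "g = (\<lambda>x. f x + (1 / (2 * e)) * inner (A x - b) (A x - b) + (e / 2) * inner x x)"
      by (auto simp: g_def power2_norm_eq_inner)
    have "((\<lambda>x. inner (A x - b) (A x - b)) has_derivative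
        (\<lambda>h. inner (A x - b) (A h) + inner (A h) (A x - b))) (at x)"
      by (auto intro!: derivative_eq_intros A_has_derivative)
    moreover have "((\<lambda>x. inner x x) has_derivative (\<lambda>h. inner x h + inner h x)) (at x)"
      by (auto intro!: derivative_eq_intros)
    ultimately have "(g has_derivative (\<lambda>h. inner h (gradf x)
        + (1 / (2 * e)) * (inner (A x - b) (A h) + inner (A h) (A x - b))
        + (e / 2) * (inner x h + inner h x))) (at x)"
      unfolding g_eq
      by (intro has_derivative_add has_derivative_mult_right f_has_derivative)
    then show ?thesis
      by (simp add: inner_commute add_divide_distrib flip: mult_2)
  qed
  then have "(\<lambda>h. inner h (gradf x) + inner (A h) ((1 / e) *\<^sub>R (A x - b)) + e * inner h x) = (\<lambda>h. 0)"
    by (rule differential_zero_maxmin[OF UNIV_I open_UNIV]) (use x in auto)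
  then have "\<forall>h. inner h (gradf x) + inner (A h) ((1 / e) *\<^sub>R (A x - b)) + e * inner h x = 0" by meson
  then have "kkt e (x, (1 / e) *\<^sub>R (A x - b))" using e by (simp add: kkt_def)
  then show ?thesis by (rule that)
qed

lemma the_saddle_point_reg:
  assumes "e > 0"
  shows "kkt e (the_saddle_point (reg e))"
proof -
  obtain z where "kkt e z" using kkt_exists[OF assms] .
  then have "the_saddle_point (reg e) = z"
    unfolding the_saddle_point_def using kkt_unique[OF _ _ assms] assms
    by (intro the_equality) (auto simp only: saddle_points_reg_iff less_imp_le)
  then show ?thesis using \<open>kkt e z\<close> by simp
qed

text \<open>This is kept beside the weaker norm comparison because it survives the limit along the
  path, where it becomes the variational inequality of the projection of 0 onto the solution
  set.\<close>

lemma kkt_inner_bound: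
  assumes "kkt e z" "kkt 0 w" "e > 0"
  shows "(norm z)\<^sup>2 \<le> inner z w"
proof -
  have "e * inner (z - w) z \<le> 0" using kkt_monotone[OF assms(1,2)] by simp
  then have "inner (z - w) z \<le> 0" using assms(3) by (simp add: mult_le_0_iff)
  then show ?thesis by (simp add: power2_norm_eq_inner inner_diff_left inner_commute[of z w])
qed

lemma kkt_norm_le:
  assumes "kkt e z" "kkt 0 w" "e > 0"
  shows "norm z \<le> norm w"
proof (cases "norm z = 0")
  case False
  have "norm z * norm z \<le> norm z * norm w"
    using kkt_inner_bound[OF assms] norm_cauchy_schwarz[of z w] by (simp add: power2_eq_square)
  then show ?thesis using False by (simp add: mult_le_cancel_left)
qed simp

section \<open>Convergence of the path to the minimum norm solution\<close>

text \<open>The norms along the path increase and are bounded by the norm of any solution, so their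
  squares converge to the supremum \<open>S\<close>. The pair estimate bounds squared distances by
  differences of squared norms, which gives the Cauchy property; the limit then inherits the
  stationarity system.\<close>

lemma kkt_path_converges:
  fixes t0 :: real
  assumes Z: "\<And>t. t \<ge> t0 \<Longrightarrow> kkt (ep t) (Z t)"
    and pos: "\<And>t. t \<ge> t0 \<Longrightarrow> ep t > 0"
    and anti: "\<And>t u. t0 \<le> t \<Longrightarrow> t \<le> u \<Longrightarrow> ep u \<le> ep t"
    and lim: "(ep \<longlongrightarrow> 0) at_top"
    and w0: "kkt 0 w0"
  shows "(Z \<longlongrightarrow> min_norm_element {w. kkt 0 w}) at_top"
    and "kkt 0 (min_norm_element {w. kkt 0 w})"
proof -
  have diff: "(norm (Z t - Z u))\<^sup>2 \<le> (norm (Z u))\<^sup>2 - (norm (Z t))\<^sup>2" if "t0 \<le> t" "t \<le> u" for t u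
    using tikhonov_pair_norm[OF kkt_monotone[OF Z Z]] pos anti that by auto
  have bound: "norm (Z t) \<le> norm w" if "t \<ge> t0" "kkt 0 w" for t w
    using kkt_norm_le[OF Z that(2)] pos that by blast
  define S where "S = (SUP t\<in>{t0..}. (norm (Z t))\<^sup>2)"
  have bdd: "bdd_above ((\<lambda>t. (norm (Z t))\<^sup>2) ` {t0..})"
    using bound w0 by (intro bdd_aboveI2[of _ _ "(norm w0)\<^sup>2"] power_mono) auto
  have S_ge: "(norm (Z t))\<^sup>2 \<le> S" if "t \<ge> t0" for t
    unfolding S_def by (rule cSUP_upper[OF _ bdd]) (use that in auto)
  have diffS: "(norm (Z t - Z u))\<^sup>2 \<le> S - (norm (Z t))\<^sup>2" if "t0 \<le> t" "t \<le> u" for t u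
    using diff[OF that] S_ge[OF order_trans[OF that]] by linarith
  have ev: "\<exists>T\<ge>t0. \<forall>t\<ge>T. S - (norm (Z t))\<^sup>2 < d" if "d > 0" for d
  proof -
    have "S - d < S" using that by simp
    then obtain T where T: "T \<ge> t0" "S - d < (norm (Z T))\<^sup>2"
      unfolding S_def using less_cSUP_iff[OF _ bdd, of "S - d"] by (auto simp: S_def)
    have "S - (norm (Z t))\<^sup>2 < d" if "t \<ge> T" for t
    proof -
      have "0 \<le> (norm (Z T - Z t))\<^sup>2" by simp
      then show ?thesis using diff[OF T(1) that] T(2) by linarith
    qed
    then show ?thesis using T(1) by blast
  qed
  have "Cauchy (\<lambda>n. Z (t0 + real n))"
  proof (rule CauchyI')
    fix d :: real assume "d > 0"
    then obtain T where T: "T \<ge> t0" "\<And>t. t \<ge> T \<Longrightarrow> S - (norm (Z t))\<^sup>2 < d\<^sup>2" using ev[of "d\<^sup>2"] by auto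
    obtain N where N: "T - t0 \<le> real N" using real_arch_simple by blast
    have "norm (Z (t0 + real m) - Z (t0 + real n)) < d" if "m \<ge> N" "n > m" for m n
    proof -
      have "T \<le> t0 + real m" using N that(1) by (simp add: of_nat_le_iff[symmetric, where 'a=real] del: of_nat_le_iff)
      then have "(norm (Z (t0 + real m) - Z (t0 + real n)))\<^sup>2 < d\<^sup>2"
        using diffS[of "t0 + real m" "t0 + real n"] T(2)[of "t0 + real m"] that(2) by fastforce
      then show ?thesis using \<open>d > 0\<close> by (simp add: power_less_imp_less_base)
    qed
    then show "\<exists>M. \<forall>m\<ge>M. \<forall>n>m. dist (Z (t0 + real m)) (Z (t0 + real n)) < d" unfolding dist_norm by blast
  qed
  then obtain z where z: "(\<lambda>n. Z (t0 + real n)) \<longlonglongrightarrow> z" using Cauchy_convergent_iff convergent_def by blast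
  \<comment> \<open>The limit was obtained along \<open>t0 + real n\<close> only; this bound extends
    convergence to all real times.\<close>
  have zt: "(norm (Z t - z))\<^sup>2 \<le> S - (norm (Z t))\<^sup>2" if "t \<ge> t0" for t
  proof (rule LIMSEQ_le_const2)
    show "(\<lambda>n. (norm (Z t - Z (t0 + real n)))\<^sup>2) \<longlonglongrightarrow> (norm (Z t - z))\<^sup>2"
      by (intro tendsto_intros z)
    obtain N where N: "t - t0 \<le> real N" using real_arch_simple by blast
    have "(norm (Z t - Z (t0 + real n)))\<^sup>2 \<le> S - (norm (Z t))\<^sup>2" if "n \<ge> N" for n
    proof -
      have "t - t0 \<le> real n" using N that by linarith
      then show ?thesis using diffS[OF \<open>t \<ge> t0\<close>, of "t0 + real n"] by simp
    qed
    then show "\<exists>N. \<forall>n\<ge>N. (norm (Z t - Z (t0 + real n)))\<^sup>2 \<le> S - (norm (Z t))\<^sup>2" by blast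
  qed
  have Zz: "(Z \<longlongrightarrow> z) at_top"
  proof (rule tendstoI)
    fix d :: real assume "d > 0"
    then obtain T where T: "T \<ge> t0" "\<And>t. t \<ge> T \<Longrightarrow> S - (norm (Z t))\<^sup>2 < d\<^sup>2" using ev[of "d\<^sup>2"] by auto
    have "dist (Z t) z < d" if "t \<ge> T" for t
    proof -
      have "(norm (Z t - z))\<^sup>2 < d\<^sup>2" using zt[of t] T that by fastforce
      then show ?thesis using \<open>d > 0\<close> by (simp add: dist_norm power_less_imp_less_base)
    qed
    then show "\<forall>\<^sub>F t in at_top. dist (Z t) z < d" using eventually_at_top_linorder by blast
  qed
  have evt: "eventually (\<lambda>t. t \<ge> t0) at_top" by (rule eventually_ge_at_top)
  have kz: "kkt 0 z"
  proof -
    have fs: "((\<lambda>t. fst (Z t)) \<longlongrightarrow> fst z) at_top" "((\<lambda>t. snd (Z t)) \<longlongrightarrow> snd z) at_top"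
      using Zz by (auto intro: tendsto_fst tendsto_snd)
    have gf: "((\<lambda>t. gradf (fst (Z t))) \<longlongrightarrow> gradf (fst z)) at_top"
      using continuous_on_tendsto_compose[OF grad_cont fs(1)] by simp
    have "inner h (gradf (fst z)) + inner (A h) (snd z) + 0 * inner h (fst z) = 0" for h
    proof (rule tendsto_unique)
      show "((\<lambda>t. inner h (gradf (fst (Z t))) + inner (A h) (snd (Z t)) + ep t * inner h (fst (Z t))) \<longlongrightarrow>
        inner h (gradf (fst z)) + inner (A h) (snd z) + 0 * inner h (fst z)) at_top"
        by (intro tendsto_intros gf fs lim)
      show "((\<lambda>t. inner h (gradf (fst (Z t))) + inner (A h) (snd (Z t)) + ep t * inner h (fst (Z t))) \<longlongrightarrow> 0) at_top"
        by (rule tendsto_eventually, rule eventually_mono[OF evt]) (use Z in \<open>auto simp: kkt_def split_beta\<close>)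
    qed simp
    moreover have "A (fst z) - b - 0 *\<^sub>R snd z = 0"
    proof (rule tendsto_unique)
      show "((\<lambda>t. A (fst (Z t)) - b - ep t *\<^sub>R snd (Z t)) \<longlongrightarrow> A (fst z) - b - 0 *\<^sub>R snd z) at_top"
        by (intro tendsto_intros A_tendsto fs lim)
      show "((\<lambda>t. A (fst (Z t)) - b - ep t *\<^sub>R snd (Z t)) \<longlongrightarrow> 0) at_top"
        by (rule tendsto_eventually, rule eventually_mono[OF evt]) (use Z in \<open>auto simp: kkt_def split_beta\<close>)
    qed simp
    ultimately show ?thesis by (simp add: kkt_def split_beta)
  qed
  have inn: "(norm z)\<^sup>2 \<le> inner z w" if "kkt 0 w" for w
  proof (rule tendsto_le[OF _ _ _ eventually_mono[OF evt]])
    show "((\<lambda>t. (norm (Z t))\<^sup>2) \<longlongrightarrow> (norm z)\<^sup>2) at_top" "((\<lambda>t. inner (Z t) w) \<longlongrightarrow> inner z w) at_top"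
      by (intro tendsto_intros Zz)+
    show "(norm (Z t))\<^sup>2 \<le> inner (Z t) w" if "t0 \<le> t" for t
      using kkt_inner_bound[OF Z \<open>kkt 0 w\<close> pos] that by blast
  qed simp
  have le: "norm z \<le> norm w" if "kkt 0 w" for w
    by (rule tendsto_upperbound[OF tendsto_norm[OF Zz] eventually_mono[OF evt]]) (use bound that in auto)
  have "min_norm_element {w. kkt 0 w} = z"
    unfolding min_norm_element_def
  proof (rule the_equality)
    show "z \<in> {w. kkt 0 w} \<and> (\<forall>w\<in>{w. kkt 0 w}. norm z \<le> norm w)" using kz le by simp
    fix w assume w: "w \<in> {w. kkt 0 w} \<and> (\<forall>v\<in>{w. kkt 0 w}. norm w \<le> norm v)"
    then have "norm w = norm z" using kz le by (intro antisym) blast+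
    then have "(norm w)\<^sup>2 = (norm z)\<^sup>2" by simp
    moreover have "(norm z)\<^sup>2 \<le> inner z w" using inn w by blast
    \<comment> \<open>With equal norms, the projection inequality \<open>inn\<close> makes the
      expanded square nonpositive; this is the uniqueness behind the definite description.\<close>
    ultimately have "(norm (w - z))\<^sup>2 \<le> 0"
      by (simp add: power2_norm_eq_inner inner_diff_left inner_diff_right inner_commute[of w z])
    then show "w = z" by simp
  qed
  then show "(Z \<longlongrightarrow> min_norm_element {w. kkt 0 w}) at_top" "kkt 0 (min_norm_element {w. kkt 0 w})"
    using Zz kz by auto
qed

text \<open>Moving the saddle point changes the gap by no more than the derivative of \<open>reg\<close> in its
  parameters alone (an exact envelope estimate), so differentiability of the path is not needed.\<close>

lemma gap_shift:
  assumes "kkt e (x, l)" "0 \<le> e"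
  shows "reg d y l' - reg d x' l' \<le> reg e y l - reg e x l
    + inner (l' - l) (A (y - x')) + (e - d) / 2 * ((norm x')\<^sup>2 - (norm y)\<^sup>2)"
proof -
  have "inner (x' - x) (gradf x) + inner (A (x' - x)) l + e * inner (x' - x) x = 0"
    using assms(1) by (simp add: kkt_def)
  moreover have "f x + inner (gradf x) (x' - x) \<le> f x'" by (rule f_tangent)
  moreover have "0 \<le> e * inner (x' - x) (x' - x)" using assms by simp
  ultimately show ?thesis
    unfolding reg_def power2_norm_eq_inner
    by (simp add: A_diff inner_simps inner_commute field_simps)
qed

lemma reg_compose_derivative:
  assumes "(g has_vector_derivative g') (at t)"
  shows "((\<lambda>u. reg e (g u) l) has_real_derivative
    inner g' (gradf (g t)) + inner (A g') l + e * inner g' (g t)) (at t)"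
proof -
  have "(g has_derivative (\<lambda>h. h *\<^sub>R g')) (at t)"
    using assms by (simp add: has_vector_derivative_def)
  then have "((\<lambda>u. reg e (g u) l) has_derivative
    (\<lambda>h. inner (h *\<^sub>R g') (gradf (g t)) + inner (A (h *\<^sub>R g')) l + e * inner (h *\<^sub>R g') (g t))) (at t)"
    by (rule has_derivative_compose[OF _ reg_has_derivative])
  moreover have "(\<lambda>h. inner (h *\<^sub>R g') (gradf (g t)) + inner (A (h *\<^sub>R g')) l + e * inner (h *\<^sub>R g') (g t))
    = (*) (inner g' (gradf (g t)) + inner (A g') l + e * inner g' (g t))"
    by (auto simp: A_scaleR algebra_simps)
  ultimately show ?thesis by (simp add: has_field_derivative_def)
qed

end

section \<open>The flow and its energy\<close>

text \<open>After the last time at which \<open>F\<close> is at most \<open>M\<close>, the function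
  would have to stay above \<open>M\<close>; but by continuity it equals \<open>M\<close> at that
  time, and the decreasing majorant through this point pushes it below. Only contacts with the level
  \<open>M\<close> have to be examined.\<close>

lemma barrier_le:
  fixes F :: "real \<Rightarrow> real"
  assumes cont: "continuous_on {T..} F" and init: "F T \<le> M"
    and step: "\<And>t. T \<le> t \<Longrightarrow> F t = M \<Longrightarrow>
      \<exists>H D. (H has_real_derivative D) (at t) \<and> D < 0 \<and> H t = M \<and> (\<forall>u\<ge>t. F u \<le> H u)"
    and "T \<le> t"
  shows "F t \<le> M"
proof (rule ccontr)
  assume gt: "\<not> F t \<le> M"
  define S where "S = {u \<in> {T..t}. F u \<le> M}"
  have cont': "continuous_on {T..t} F" using cont by (rule continuous_on_subset) auto
  have "closed S" unfolding S_def
    by (intro continuous_on_closed_Collect_le cont' continuous_on_const) auto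
  moreover have "T \<in> S" using init \<open>T \<le> t\<close> by (auto simp: S_def)
  moreover have bdd: "bdd_above S" by (auto simp: S_def)
  ultimately have "Sup S \<in> S" by (intro closed_contains_Sup) auto
  define u where "u = Sup S"
  have u: "T \<le> u" "u \<le> t" "F u \<le> M" using \<open>Sup S \<in> S\<close> by (auto simp: u_def S_def)
  have "u \<noteq> t" using u gt by auto
  then have "u < t" using u by simp
  have above: "M < F v" if "u < v" "v \<le> t" for v
    using cSup_upper[OF _ bdd, of v] that u by (fastforce simp: S_def u_def)
  have "F u = M"
  proof (rule antisym)
    have "(F \<longlongrightarrow> F u) (at u within {T..t})"
      using cont' u by (auto simp: continuous_on_def)
    then have "(F \<longlongrightarrow> F u) (at u within {u..t})"
      by (rule tendsto_within_subset) (use u in auto)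
    then have "(F \<longlongrightarrow> F u) (at_right u)"
      using at_within_Icc_at_right[OF \<open>u < t\<close>] by simp
    moreover have "\<forall>\<^sub>F v in at_right u. M \<le> F v"
      unfolding eventually_at_right_field using \<open>u < t\<close> above by (meson less_imp_le)
    ultimately show "M \<le> F u" by (intro tendsto_lowerbound) auto
  qed (rule u)
  then obtain H D where H: "(H has_real_derivative D) (at u)" "D < 0" "H u = M" "\<forall>v\<ge>u. F v \<le> H v"
    using step u by blast
  obtain d where d: "d > 0" "\<And>h. 0 < h \<Longrightarrow> h < d \<Longrightarrow> H (u + h) < H u"
    using DERIV_neg_dec_right[OF H(1,2)] by auto
  define h where "h = min (d / 2) (t - u)"
  have "0 < h" "h < d" "u + h \<le> t" using d \<open>u < t\<close> by (auto simp: h_def)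
  have "F (u + h) \<le> H (u + h)" "H (u + h) < M" "M < F (u + h)"
    using H(3,4) d(2)[OF \<open>0 < h\<close> \<open>h < d\<close>] above[of "u + h"] \<open>0 < h\<close> \<open>u + h \<le> t\<close> by auto
  then show False by simp
qed

text \<open>The corrections in the majorant involve norms, which need not be differentiable where
  they vanish. The factor \<open>u - t\<close> makes continuity sufficient.\<close>

lemma has_real_derivative_shift_mult:
  fixes g :: "real \<Rightarrow> real"
  assumes "isCont g t"
  shows "((\<lambda>u. (u - t) * g u) has_real_derivative g t) (at t)"
proof -
  have "((\<lambda>u. ((u - t) * g u - (t - t) * g t) / (u - t)) \<longlongrightarrow> g t) (at t)"
  proof (rule Lim_transform_eventually)
    show "(g \<longlongrightarrow> g t) (at t)" using assms by (simp add: isCont_def)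
    show "\<forall>\<^sub>F u in at t. g u = ((u - t) * g u - (t - t) * g t) / (u - t)"
      unfolding eventually_at_filter by (auto intro!: always_eventually)
  qed
  then show ?thesis by (simp add: has_field_derivative_iff)
qed

text \<open>Both sides enclose \<open>p * ln (u / t)\<close>, by \<open>1 + y \<le> exp y\<close> on
  the left and \<open>ln y \<le> y - 1\<close> on the right. It measures the relative decrease of
  the regularization parameter.\<close>

lemma one_minus_powr_ratio_le:
  fixes t u p :: real
  assumes "0 < t" "t \<le> u" "0 \<le> p"
  shows "1 - (t / u) powr p \<le> p / t * (u - t)"
proof -
  have "ln (u / t) \<le> u / t - 1" using assms by (intro ln_le_minus_one) auto
  then have "- (p * ln (t / u)) \<le> p * (u / t - 1)"
    using assms by (simp add: ln_div mult_left_mono flip: mult_minus_right)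
  moreover have "1 + p * ln (t / u) \<le> exp (p * ln (t / u))" by (rule exp_ge_add_one_self)
  ultimately have "1 - exp (p * ln (t / u)) \<le> p * (u / t - 1)" by linarith
  then show ?thesis using assms by (simp add: powr_def field_simps)
qed

section \<open>Setting of the flow and drift of the saddle point\<close>

text \<open>The path enters only through its stationarity system and a uniform bound
  \<open>R\<close>, so that its definition as a choice plays no part in the estimates.\<close>

locale primal_dual_flow = convex_saddle +
  fixes t0 \<alpha> \<theta> q p c s :: real
    and x x' x'' :: "real \<Rightarrow> 'a" and l l' :: "real \<Rightarrow> 'b"
    and z :: "real \<Rightarrow> 'a \<times> 'b" and R :: real
  assumes t0: "t0 > 0" and \<alpha>: "\<alpha> > 0" and \<theta>: "\<theta> > 1 / \<alpha>" and q: "0 \<le> q" "q < 1"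
    and p: "0 < p" "p < 1 - q" and c: "c > 0"
    and sol: "primal_dual_solution gradf A b t0 \<alpha> \<theta> q p s c x x' x'' l l'"
    and path: "t \<ge> t0 \<Longrightarrow> kkt (c / t powr p) (z t)"
    and R: "t \<ge> t0 \<Longrightarrow> norm (z t) \<le> R"
begin

definition ep :: "real \<Rightarrow> real" where "ep t = c / t powr p"

definition a :: real where "a = 1 / \<theta>"

definition gap :: "real \<Rightarrow> real" where
  "gap t = reg (ep t) (x t) (snd (z t)) - reg (ep t) (fst (z t)) (snd (z t))"

definition energy :: "real \<Rightarrow> real" where
  "energy t = t powr (2 * q + s) * gap t
    + (norm (a *\<^sub>R (x t - fst (z t)) + t powr q *\<^sub>R x' t))\<^sup>2 / 2
    + a * (\<alpha> - a) / 2 * (norm (x t - fst (z t)))\<^sup>2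
    + a / 2 * (norm (l t - snd (z t)))\<^sup>2"

lemma a: "0 < a" "a < \<alpha>"
proof -
  have "0 < \<theta>" using \<alpha> \<theta> by (meson divide_pos_pos less_trans zero_less_one)
  then show "0 < a" "a < \<alpha>" using \<alpha> \<theta> by (auto simp: a_def field_simps)
qed

lemma a\<theta>: "a * \<theta> = 1"
  using a by (auto simp: a_def)

lemma R_nonneg: "0 \<le> R"
  using R[of t0] norm_ge_zero order_trans by blast

lemma kkt_ep: "t \<ge> t0 \<Longrightarrow> kkt (ep t) (z t)"
  using path by (simp add: ep_def)

lemma ep_pos: "t \<ge> t0 \<Longrightarrow> 0 < ep t"
  using t0 c by (simp add: ep_def)

lemma ep_antimono: "t0 \<le> t \<Longrightarrow> t \<le> u \<Longrightarrow> ep u \<le> ep t"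
  using t0 c p by (auto simp: ep_def intro!: divide_left_mono powr_mono2)

lemma ep_diff:
  assumes "t0 \<le> t" "t \<le> u"
  shows "ep t - ep u \<le> ep t * (p / t * (u - t))"
proof -
  have "ep u = ep t * (t / u) powr p"
    using assms t0 by (simp add: ep_def powr_divide)
  then have "ep t - ep u = ep t * (1 - (t / u) powr p)" by (simp add: algebra_simps)
  also have "\<dots> \<le> ep t * (p / t * (u - t))"
    using one_minus_powr_ratio_le[of t u p] ep_pos[of t] assms t0 p by (intro mult_left_mono) auto
  finally show ?thesis .
qed

text \<open>Only the relative change of the parameter matters, and for a power of \<open>t\<close>
  it is at most \<open>p / t\<close> per unit of time; \<open>c\<close> and the size of the
  parameter drop out.\<close>

lemma path_lipschitz:
  assumes "t0 \<le> t" "t \<le> u"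
  shows "norm (z t - z u) \<le> R * p / t * (u - t)"
proof -
  have "norm (z t - z u) \<le> (ep t - ep u) / ep t * norm (z u)"
    using assms by (intro tikhonov_pair_lipschitz[OF kkt_monotone[OF kkt_ep kkt_ep]] ep_pos ep_antimono) auto
  also have "\<dots> \<le> (ep t * (p / t * (u - t))) / ep t * R"
    using assms ep_pos[of t] R[of u] ep_diff[OF assms] t0 p
    by (intro mult_mono divide_right_mono) auto
  also have "\<dots> = R * p / t * (u - t)" using ep_pos[of t] assms by simp
  finally show ?thesis .
qed

lemma path_continuous: "continuous_on {t0..} z"
proof (rule lipschitz_on_continuous_on)
  have "dist (z t) (z u) \<le> R * p / t0 * dist t u" if "t0 \<le> t" "t \<le> u" for t u
  proof -
    have "R * p / t * (u - t) \<le> R * p / t0 * (u - t)"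
      using that t0 p R_nonneg by (intro mult_right_mono divide_left_mono) auto
    then show ?thesis using path_lipschitz[OF that] that by (simp add: dist_norm)
  qed
  then have "dist (z t) (z u) \<le> R * p / t0 * dist t u" if "t0 \<le> t" "t0 \<le> u" for t u
    using that by (metis dist_commute linear)
  then show "(R * p / t0)-lipschitz_on {t0..} z"
    using t0 p R_nonneg by (intro lipschitz_onI) auto
qed

lemma x_deriv: "t > t0 \<Longrightarrow> (x has_vector_derivative x' t) (at t)"
  and x'_deriv: "t > t0 \<Longrightarrow> (x' has_vector_derivative x'' t) (at t)"
  and l_deriv: "t > t0 \<Longrightarrow> (l has_vector_derivative l' t) (at t)"
proof -
  assume "t > t0"
  then have "at t within {t0..} = at t" by (intro at_within_interior) (simp add: interior_real_atLeast)
  then show "(x has_vector_derivative x' t) (at t)" "(x' has_vector_derivative x'' t) (at t)"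
    "(l has_vector_derivative l' t) (at t)"
    using sol \<open>t > t0\<close> unfolding primal_dual_solution_def by (metis less_imp_le)+
qed

lemma flow_continuous:
  assumes "T > t0"
  shows "continuous_on {T..} x" "continuous_on {T..} x'" "continuous_on {T..} l"
proof -
  have t: "t > t0" if "t \<in> {T..}" for t using assms that by simp
  show "continuous_on {T..} x"
    by (intro continuous_at_imp_continuous_on ballI has_vector_derivative_continuous[OF x_deriv] t)
  show "continuous_on {T..} x'"
    by (intro continuous_at_imp_continuous_on ballI has_vector_derivative_continuous[OF x'_deriv] t)
  show "continuous_on {T..} l"
    by (intro continuous_at_imp_continuous_on ballI has_vector_derivative_continuous[OF l_deriv] t)
qed

lemma gap_nonneg:
  assumes "t \<ge> t0"
  shows "0 \<le> gap t"
proof -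
  have "z t \<in> saddle_points (reg (ep t))"
    using kkt_ep[OF assms] ep_pos[OF assms] by (simp add: saddle_points_reg_iff)
  then show ?thesis by (auto simp: saddle_points_def gap_def)
qed

lemma energy_continuous:
  assumes "T > t0"
  shows "continuous_on {T..} energy"
proof -
  have z: "continuous_on {T..} z" using path_continuous by (rule continuous_on_subset) (use assms in auto)
  note xc = flow_continuous[OF assms]
  have e: "continuous_on {T..} ep"
    unfolding ep_def using assms t0 by (intro continuous_intros) auto
  have f: "continuous_on {T..} (\<lambda>t. f (g t))" if "continuous_on {T..} g" for g
    using continuous_on_compose2[OF f_continuous that] by simp
  have A': "continuous_on {T..} (\<lambda>t. A (g t))" if "continuous_on {T..} g" for g
    using that by (rule A_continuous_on)
  show ?thesis
    unfolding energy_def gap_def reg_def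
    using assms t0 by (intro continuous_intros z xc e f A') auto
qed

end

section \<open>One-sided differentiation of the energy\<close>

text \<open>With \<open>d\<close> proportional to \<open>u - t\<close> the error carries the factor
  \<open>u - t\<close> that the majorant needs.\<close>

lemma norm_sq_le_of_close:
  fixes v w :: "'a::real_inner"
  assumes "norm (v - w) \<le> d"
  shows "(norm v)\<^sup>2 \<le> inner w w + (2 * d * norm w + d\<^sup>2)"
proof -
  have "norm v \<le> norm w + d" using assms norm_triangle_ineq[of w "v - w"] by simp
  then have "(norm v)\<^sup>2 \<le> (norm w + d)\<^sup>2" by (intro power_mono) auto
  then show ?thesis by (simp add: power2_sum power2_norm_eq_inner algebra_simps)
qed

lemma has_real_derivative_inner_self:
  assumes "(g has_vector_derivative g') (at t)"
  shows "((\<lambda>u. inner (g u) (g u)) has_real_derivative 2 * inner (g t) g') (at t)"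
  using bounded_bilinear.has_vector_derivative[OF bounded_bilinear_inner assms assms]
  by (simp add: has_real_derivative_iff_has_vector_derivative inner_commute)

context primal_dual_flow begin

text \<open>The right-hand side sees the saddle point at the fixed time \<open>t\<close> only. The
  drift of the multiplier acts through \<open>A\<close>, the decrease of the parameter through a
  difference of squared norms; both cost at most the elapsed time multiplied by the drift speed and
  the distance from the path.\<close>

lemma gap_shift_bound:
  assumes t: "t0 \<le> t" and u: "t \<le> u"
  defines "\<kappa> \<equiv> R * p / t"
  shows "gap u \<le> reg (ep t) (x u) (snd (z t)) - reg (ep t) (fst (z t)) (snd (z t))
    + (u - t) * (\<kappa> * (onorm A + ep t) * (norm (x u - fst (z t)) + \<kappa> * (u - t)))"
proof -
  obtain y m where zt: "z t = (y, m)" by fastforce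
  obtain y' m' where zu: "z u = (y', m')" by fastforce
  have kh: "norm (y - y') \<le> \<kappa> * (u - t)" "norm (m - m') \<le> \<kappa> * (u - t)"
    using path_lipschitz[OF t u] norm_fst_le[of "y - y'" "m - m'"] norm_snd_le[of "m - m'" "y - y'"]
    by (simp_all add: zt zu \<kappa>_def)
  define \<rho> where "\<rho> = norm (x u - y) + \<kappa> * (u - t)"
  have \<rho>: "norm (x u - y') \<le> \<rho>"
    using kh(1) norm_triangle_ineq[of "x u - y" "y - y'"] by (simp add: \<rho>_def)
  have \<rho>0: "0 \<le> \<rho>" using \<rho> norm_ge_zero order_trans by blast
  have kh0: "0 \<le> \<kappa> * (u - t)" using kh norm_ge_zero order_trans by blast
  have "inner (m' - m) (A (x u - y')) \<le> norm (m' - m) * norm (A (x u - y'))" by (rule norm_cauchy_schwarz)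
  also have "\<dots> \<le> (\<kappa> * (u - t)) * (onorm A * \<rho>)"
  proof (rule mult_mono)
    have "norm (A (x u - y')) \<le> onorm A * norm (x u - y')" by (rule onorm[OF A])
    also have "\<dots> \<le> onorm A * \<rho>" using \<rho> onorm_pos_le[OF A] by (rule mult_left_mono)
    finally show "norm (A (x u - y')) \<le> onorm A * \<rho>" .
  qed (use kh kh0 in \<open>auto simp: norm_minus_commute\<close>)
  finally have 1: "inner (m' - m) (A (x u - y')) \<le> (\<kappa> * (u - t)) * (onorm A * \<rho>)" .
  \<comment> \<open>Expanding around \<open>y'\<close> leaves a linear term and a negative square;
    dropping the square makes the bound linear in the distance.\<close>
  have "(norm y')\<^sup>2 - (norm (x u))\<^sup>2 \<le> 2 * (R * \<rho>)"
  proof -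
    have "norm y' \<le> R" using R[of u] norm_fst_le[of y' m'] t u by (simp add: zu)
    then have "norm y' * norm (x u - y') \<le> R * \<rho>"
      using \<rho> R_nonneg by (intro mult_mono) auto
    then have "- inner y' (x u - y') \<le> R * \<rho>" using Cauchy_Schwarz_ineq2[of y' "x u - y'"] by linarith
    moreover have "0 \<le> inner (x u - y') (x u - y')" by simp
    ultimately show ?thesis unfolding power2_norm_eq_inner
      by (simp add: inner_diff_left inner_diff_right inner_commute)
  qed
  then have "(ep t - ep u) / 2 * ((norm y')\<^sup>2 - (norm (x u))\<^sup>2) \<le> (ep t - ep u) / 2 * (2 * (R * \<rho>))"
    using ep_antimono[OF t u] by (intro mult_left_mono) auto
  also have "\<dots> = (ep t - ep u) * (R * \<rho>)" by simp
  also have "\<dots> \<le> (ep t * (p / t * (u - t))) * (R * \<rho>)"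
    using ep_diff[OF t u] R_nonneg \<rho>0 by (intro mult_right_mono) auto
  finally have 2: "(ep t - ep u) / 2 * ((norm y')\<^sup>2 - (norm (x u))\<^sup>2) \<le> (\<kappa> * (u - t)) * (ep t * \<rho>)"
    by (simp add: \<kappa>_def mult_ac)
  have "kkt (ep t) (y, m)" using kkt_ep[OF t] by (simp add: zt)
  then have "gap u \<le> reg (ep t) (x u) m - reg (ep t) y m
      + inner (m' - m) (A (x u - y')) + (ep t - ep u) / 2 * ((norm y')\<^sup>2 - (norm (x u))\<^sup>2)"
    unfolding gap_def zu using gap_shift[of "ep t" y m "ep u" "x u" m' y'] ep_pos[OF t] by simp
  also have "\<dots> \<le> reg (ep t) (x u) m - reg (ep t) y m
      + (\<kappa> * (u - t)) * (onorm A * \<rho>) + (\<kappa> * (u - t)) * (ep t * \<rho>)"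
    using 1 2 by linarith
  also have "\<dots> = reg (ep t) (x u) m - reg (ep t) y m + (u - t) * (\<kappa> * (onorm A + ep t) * \<rho>)"
    by (simp add: algebra_simps)
  finally show ?thesis by (simp add: zt \<rho>_def)
qed

text \<open>The coupling terms in \<open>A w\<close> and \<open>l - snd (z t)\<close> cancel because of the choice \<open>a = 1 / \<theta>\<close>.\<close>

lemma energy_majorant:
  assumes t: "t > t0"
  defines "\<kappa> \<equiv> R * p / t" and "U \<equiv> norm (x t - fst (z t))" and "N \<equiv> norm (l t - snd (z t))" and "V \<equiv> norm (x' t)"
  shows "\<exists>H D. (H has_real_derivative D) (at t) \<and> H t = energy t \<and> (\<forall>u\<ge>t. energy u \<le> H u) \<and>
    D \<le> (\<bar>2 * q + s\<bar> * t powr (q - 1) - a) * (t powr (q + s) * gap t)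
      - a * c / 2 * t powr (q + s - p) * U\<^sup>2 - a * c * t powr (q + s - p) * N\<^sup>2
      - (\<alpha> - a) * t powr q * V\<^sup>2 + q * t powr (q - 1) * (a * U * V + t powr q * V\<^sup>2)
      + t powr (2 * q + s) * (\<kappa> * (onorm A + ep t) * U)
      + a * \<kappa> * (a * U + t powr q * V) + a * (\<alpha> - a) * \<kappa> * U + a * \<kappa> * N"
proof -
  have tp: "t > 0" "t \<ge> t0" using t t0 by auto
  obtain y m where zt: "z t = (y, m)" by fastforce
  define e where "e = ep t"
  define w where "w u = a *\<^sub>R (x u - y) + u powr q *\<^sub>R x' u" for u
  define C where "C = \<kappa> * (onorm A + e)"
  \<comment> \<open>Each term of the energy is evaluated with the saddle point of time
    \<open>t\<close>, and the error of doing so is bounded by \<open>u - t\<close> times a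
    continuous factor. The corrections vanish at \<open>u = t\<close> and contribute just the value
    of that factor to the derivative.\<close>
  define H where "H u = u powr (2 * q + s) *
        (reg e (x u) m - reg e y m + (u - t) * (C * (norm (x u - y) + \<kappa> * (u - t))))
      + (inner (w u) (w u) + (u - t) * (2 * (a * \<kappa>) * norm (w u) + (a * \<kappa>)\<^sup>2 * (u - t))) / 2
      + a * (\<alpha> - a) / 2 * (inner (x u - y) (x u - y) + (u - t) * (2 * \<kappa> * norm (x u - y) + \<kappa>\<^sup>2 * (u - t)))
      + a / 2 * (inner (l u - m) (l u - m) + (u - t) * (2 * \<kappa> * norm (l u - m) + \<kappa>\<^sup>2 * (u - t)))" for u
  have "H t = energy t"
    by (simp add: H_def energy_def gap_def zt e_def w_def power2_norm_eq_inner)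
  have "energy u \<le> H u" if u: "t \<le> u" for u
  proof -
    obtain y' m' where zu: "z u = (y', m')" by fastforce
    have kh: "norm (y - y') \<le> \<kappa> * (u - t)" "norm (m - m') \<le> \<kappa> * (u - t)"
      using path_lipschitz[OF tp(2) u] norm_fst_le[of "y - y'" "m - m'"] norm_snd_le[of "m - m'" "y - y'"]
      by (simp_all add: zt zu \<kappa>_def)
    have "u powr (2 * q + s) * gap u \<le> u powr (2 * q + s) *
        (reg e (x u) m - reg e y m + (u - t) * (C * (norm (x u - y) + \<kappa> * (u - t))))"
      using gap_shift_bound[OF tp(2) u] by (intro mult_left_mono) (auto simp: zt e_def C_def \<kappa>_def)
    moreover have "(norm (a *\<^sub>R (x u - y') + u powr q *\<^sub>R x' u))\<^sup>2 / 2
        \<le> (inner (w u) (w u) + (u - t) * (2 * (a * \<kappa>) * norm (w u) + (a * \<kappa>)\<^sup>2 * (u - t))) / 2"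
    proof -
      have "(a *\<^sub>R (x u - y') + u powr q *\<^sub>R x' u) - w u = a *\<^sub>R (y - y')"
        by (simp add: w_def algebra_simps)
      then have "norm ((a *\<^sub>R (x u - y') + u powr q *\<^sub>R x' u) - w u) \<le> a * \<kappa> * (u - t)"
        using kh(1) a by (simp add: mult.assoc)
      from norm_sq_le_of_close[OF this] show ?thesis
        by (simp add: power_mult_distrib power2_eq_square algebra_simps)
    qed
    moreover have "a * (\<alpha> - a) / 2 * (norm (x u - y'))\<^sup>2 \<le> a * (\<alpha> - a) / 2 *
        (inner (x u - y) (x u - y) + (u - t) * (2 * \<kappa> * norm (x u - y) + \<kappa>\<^sup>2 * (u - t)))"
    proof (rule mult_left_mono)
      have "norm ((x u - y') - (x u - y)) \<le> \<kappa> * (u - t)" using kh by simp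
      from norm_sq_le_of_close[OF this]
      show "(norm (x u - y'))\<^sup>2 \<le> inner (x u - y) (x u - y)
          + (u - t) * (2 * \<kappa> * norm (x u - y) + \<kappa>\<^sup>2 * (u - t))"
        by (simp add: power_mult_distrib power2_eq_square algebra_simps)
    qed (use a in simp)
    moreover have "a / 2 * (norm (l u - m'))\<^sup>2 \<le> a / 2 *
        (inner (l u - m) (l u - m) + (u - t) * (2 * \<kappa> * norm (l u - m) + \<kappa>\<^sup>2 * (u - t)))"
    proof (rule mult_left_mono)
      have "norm ((l u - m') - (l u - m)) \<le> \<kappa> * (u - t)" using kh by simp
      from norm_sq_le_of_close[OF this]
      show "(norm (l u - m'))\<^sup>2 \<le> inner (l u - m) (l u - m)
          + (u - t) * (2 * \<kappa> * norm (l u - m) + \<kappa>\<^sup>2 * (u - t))"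
        by (simp add: power_mult_distrib power2_eq_square algebra_simps)
    qed (use a in simp)
    ultimately show ?thesis unfolding energy_def H_def zu fst_conv snd_conv by (intro add_mono)
  qed
  define w' where "w' = a *\<^sub>R x' t + (t powr q *\<^sub>R x'' t + (q * t powr (q - 1)) *\<^sub>R x' t)"
  \<comment> \<open>Directional derivative at \<open>x t\<close> of the regularized Lagrangian with
    frozen multiplier \<open>m\<close>.\<close>
  define \<gamma> where "\<gamma> h = inner h (gradf (x t)) + inner (A h) m + e * inner h (x t)" for h
  have dx: "((\<lambda>u. x u - y) has_vector_derivative x' t) (at t)"
    using has_vector_derivative_diff[OF x_deriv[OF t] has_vector_derivative_const[of y]] by simp
  have dl: "((\<lambda>u. l u - m) has_vector_derivative l' t) (at t)"
    using has_vector_derivative_diff[OF l_deriv[OF t] has_vector_derivative_const[of m]] by simp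
  have dw: "(w has_vector_derivative w') (at t)"
  proof -
    have "((\<lambda>u. u powr q) has_real_derivative q * t powr (q - 1)) (at t)"
      using tp by (auto intro!: derivative_eq_intros)
    from has_vector_derivative_scaleR[OF this x'_deriv[OF t]]
    have "((\<lambda>u. u powr q *\<^sub>R x' u) has_vector_derivative
        t powr q *\<^sub>R x'' t + (q * t powr (q - 1)) *\<^sub>R x' t) (at t)" by simp
    moreover have "((\<lambda>u. a *\<^sub>R (x u - y)) has_vector_derivative a *\<^sub>R x' t) (at t)"
      using has_vector_derivative_scaleR[OF DERIV_const[of a] dx] by simp
    ultimately show ?thesis unfolding w_def w'_def by (rule has_vector_derivative_add[rotated])
  qed
  have dr: "((\<lambda>u. reg e (x u) m) has_real_derivative \<gamma> (x' t)) (at t)"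
    unfolding \<gamma>_def by (rule reg_compose_derivative[OF x_deriv[OF t]])
  have cont: "isCont (\<lambda>u. norm (x u - y)) t" "isCont (\<lambda>u. norm (w u)) t" "isCont (\<lambda>u. norm (l u - m)) t"
    using has_vector_derivative_continuous[OF dx] has_vector_derivative_continuous[OF dw]
      has_vector_derivative_continuous[OF dl] by (auto intro: continuous_intros)
  define D where "D = (2 * q + s) * t powr (2 * q + s - 1) * gap t + t powr (2 * q + s) * (\<gamma> (x' t) + C * U)
      + (2 * inner (w t) w' + 2 * (a * \<kappa>) * norm (w t)) / 2
      + a * (\<alpha> - a) / 2 * (2 * inner (x t - y) (x' t) + 2 * \<kappa> * U)
      + a / 2 * (2 * inner (l t - m) (l' t) + 2 * \<kappa> * N)"
  have "(H has_real_derivative D) (at t)"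
  proof -
    have s1: "((\<lambda>u. (u - t) * (C * (norm (x u - y) + \<kappa> * (u - t)))) has_real_derivative C * (norm (x t - y) + \<kappa> * (t - t))) (at t)"
      by (rule has_real_derivative_shift_mult) (intro continuous_intros cont)
    have s2: "((\<lambda>u. (u - t) * (2 * (a * \<kappa>) * norm (w u) + (a * \<kappa>)\<^sup>2 * (u - t))) has_real_derivative
        2 * (a * \<kappa>) * norm (w t) + (a * \<kappa>)\<^sup>2 * (t - t)) (at t)"
      by (rule has_real_derivative_shift_mult) (intro continuous_intros cont)
    have s3: "((\<lambda>u. (u - t) * (2 * \<kappa> * norm (x u - y) + \<kappa>\<^sup>2 * (u - t))) has_real_derivative
        2 * \<kappa> * norm (x t - y) + \<kappa>\<^sup>2 * (t - t)) (at t)"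
      by (rule has_real_derivative_shift_mult) (intro continuous_intros cont)
    have s4: "((\<lambda>u. (u - t) * (2 * \<kappa> * norm (l u - m) + \<kappa>\<^sup>2 * (u - t))) has_real_derivative
        2 * \<kappa> * norm (l t - m) + \<kappa>\<^sup>2 * (t - t)) (at t)"
      by (rule has_real_derivative_shift_mult) (intro continuous_intros cont)
    have s5: "((\<lambda>u. u powr (2 * q + s)) has_real_derivative (2 * q + s) * t powr (2 * q + s - 1)) (at t)"
      using tp by (auto intro!: derivative_eq_intros)
    have "((\<lambda>u. u powr (2 * q + s) *
        (reg e (x u) m - reg e y m + (u - t) * (C * (norm (x u - y) + \<kappa> * (u - t))))) has_real_derivative
        (2 * q + s) * t powr (2 * q + s - 1) * (reg e (x t) m - reg e y m + (t - t) * (C * (norm (x t - y) + \<kappa> * (t - t))))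
        + (\<gamma> (x' t) - 0 + C * (norm (x t - y) + \<kappa> * (t - t))) * t powr (2 * q + s)) (at t)"
      by (intro DERIV_mult s5 DERIV_add DERIV_diff dr DERIV_const s1)
    then have h1: "((\<lambda>u. u powr (2 * q + s) *
        (reg e (x u) m - reg e y m + (u - t) * (C * (norm (x u - y) + \<kappa> * (u - t))))) has_real_derivative
        (2 * q + s) * t powr (2 * q + s - 1) * gap t + t powr (2 * q + s) * (\<gamma> (x' t) + C * U)) (at t)"
      by (simp add: gap_def U_def zt e_def mult.commute)
    have h2: "((\<lambda>u. (inner (w u) (w u) + (u - t) * (2 * (a * \<kappa>) * norm (w u) + (a * \<kappa>)\<^sup>2 * (u - t))) / 2)
        has_real_derivative (2 * inner (w t) w' + 2 * (a * \<kappa>) * norm (w t)) / 2) (at t)"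
      using DERIV_cdivide[OF DERIV_add[OF has_real_derivative_inner_self[OF dw] s2], of 2] by simp
    have h3: "((\<lambda>u. a * (\<alpha> - a) / 2 * (inner (x u - y) (x u - y) + (u - t) * (2 * \<kappa> * norm (x u - y) + \<kappa>\<^sup>2 * (u - t))))
        has_real_derivative a * (\<alpha> - a) / 2 * (2 * inner (x t - y) (x' t) + 2 * \<kappa> * U)) (at t)"
      using DERIV_cmult[OF DERIV_add[OF has_real_derivative_inner_self[OF dx] s3], of "a * (\<alpha> - a) / 2"]
      by (simp add: U_def zt)
    have h4: "((\<lambda>u. a / 2 * (inner (l u - m) (l u - m) + (u - t) * (2 * \<kappa> * norm (l u - m) + \<kappa>\<^sup>2 * (u - t))))
        has_real_derivative a / 2 * (2 * inner (l t - m) (l' t) + 2 * \<kappa> * N)) (at t)"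
      using DERIV_cmult[OF DERIV_add[OF has_real_derivative_inner_self[OF dl] s4], of "a / 2"]
      by (simp add: N_def zt)
    show ?thesis unfolding H_def D_def by (intro DERIV_add h1 h2 h3 h4)
  qed
  moreover have "D \<le> (\<bar>2 * q + s\<bar> * t powr (q - 1) - a) * (t powr (q + s) * gap t)
      - a * c / 2 * t powr (q + s - p) * U\<^sup>2 - a * c * t powr (q + s - p) * N\<^sup>2
      - (\<alpha> - a) * t powr q * V\<^sup>2 + q * t powr (q - 1) * (a * U * V + t powr q * V\<^sup>2)
      + t powr (2 * q + s) * (\<kappa> * (onorm A + ep t) * U)
      + a * \<kappa> * (a * U + t powr q * V) + a * (\<alpha> - a) * \<kappa> * U + a * \<kappa> * N"
  proof -
    define Q where "Q = t powr q"
    define P where "P = t powr (q + s)"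
    define \<rho> where "\<rho> = q * t powr (q - 1)"
    have pos: "0 < Q" "0 < P" "0 \<le> \<rho>" using tp q by (auto simp: Q_def P_def \<rho>_def)
    have pw: "t powr (2 * q + s) = Q * P" "t powr (2 * q + s - 1) = t powr (q - 1) * P" "P = Q * t powr s"
      "c * t powr (q + s - p) = e * P"
      using tp by (simp_all add: Q_def P_def e_def ep_def powr_add[symmetric] powr_diff algebra_simps)
    define i where "i = inner (x t - y) (x' t)"
    define n where "n = inner (A (w t)) (l t - m)"
    have kkt: "inner h (gradf y) + inner (A h) m + e * inner h y = 0" "A y - b = e *\<^sub>R m" for h
      using kkt_ep[OF tp(2)] by (auto simp: kkt_def zt e_def)
    \<comment> \<open>The tangent inequality is based at \<open>x t\<close> and evaluated at the
      saddle point. It is the source of the dissipation of the gap and, through strong convexity, of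
      \<open>U\<^sup>2\<close>.\<close>
    have \<gamma>_gap: "gap t + e / 2 * U\<^sup>2 \<le> \<gamma> (x t - y)"
      using reg_tangent[of e "x t" m y]
      by (simp add: gap_def zt U_def \<gamma>_def e_def A_diff inner_diff_left norm_minus_commute algebra_simps)
    have wt: "w t = a *\<^sub>R (x t - y) + Q *\<^sub>R x' t" by (simp add: w_def Q_def)
    have \<gamma>_w: "\<gamma> (w t) = a * \<gamma> (x t - y) + Q * \<gamma> (x' t)"
      unfolding wt \<gamma>_def A_add A_scaleR inner_add_left inner_scaleR_left by (simp add: distrib_left)
    have "x'' t + (\<alpha> / Q) *\<^sub>R x' t + t powr s *\<^sub>R (gradf (x t) + adjoint A (l t) + e *\<^sub>R x t) = 0"
      and l'_eq: "l' t - P *\<^sub>R (A (x t + (\<theta> * Q) *\<^sub>R x' t) - b - e *\<^sub>R l t) = 0"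
      using sol tp by (auto simp: primal_dual_solution_def Q_def P_def e_def ep_def)
    then have "x'' t = - ((\<alpha> / Q) *\<^sub>R x' t + t powr s *\<^sub>R (gradf (x t) + adjoint A (l t) + e *\<^sub>R x t))"
      by (metis add.assoc add_eq_0_iff2)
    then have "Q *\<^sub>R x'' t = - (\<alpha> *\<^sub>R x' t + P *\<^sub>R (gradf (x t) + adjoint A (l t) + e *\<^sub>R x t))"
      using pos by (simp add: pw(3) scaleR_right_distrib scaleR_right_diff_distrib)
    then have w'_eq: "w' = (a - \<alpha> + \<rho>) *\<^sub>R x' t - P *\<^sub>R (gradf (x t) + adjoint A (l t) + e *\<^sub>R x t)"
      by (simp add: w'_def Q_def \<rho>_def algebra_simps)
    have wx: "inner (w t) (x' t) = a * i + Q * V\<^sup>2"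
      by (simp add: wt i_def V_def inner_add_left power2_norm_eq_inner)
    have "inner h (gradf (x t) + adjoint A (l t) + e *\<^sub>R x t) = \<gamma> h + inner (A h) (l t - m)" for h
      using adjoint_hilbert[OF A, of h "l t"] by (simp add: \<gamma>_def inner_add_right inner_diff_right)
    then have ww': "inner (w t) w' = (a - \<alpha> + \<rho>) * (a * i + Q * V\<^sup>2) - P * (a * \<gamma> (x t - y) + Q * \<gamma> (x' t) + n)"
      by (simp add: w'_eq inner_diff_right wx \<gamma>_w n_def)
    \<comment> \<open>Subtracting the constraint equation of the saddle point turns the extrapolated
      point into a multiple of \<open>w t\<close>, because \<open>a * \<theta> = 1\<close>.\<close>
    have "A (x t + (\<theta> * Q) *\<^sub>R x' t) - b - e *\<^sub>R l t = \<theta> *\<^sub>R A (w t) - e *\<^sub>R (l t - m)"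
    proof -
      have "\<theta> *\<^sub>R A (w t) = (a * \<theta>) *\<^sub>R A (x t - y) + (\<theta> * Q) *\<^sub>R A (x' t)"
        unfolding wt A_add A_scaleR by (simp add: scaleR_right_distrib mult.commute)
      then have "\<theta> *\<^sub>R A (w t) = A (x t) - A y + (\<theta> * Q) *\<^sub>R A (x' t)"
        by (simp add: a\<theta> A_diff)
      then show ?thesis using kkt(2) by (simp add: A_add A_scaleR algebra_simps)
    qed
    then have "l' t = P *\<^sub>R (\<theta> *\<^sub>R A (w t) - e *\<^sub>R (l t - m))" using l'_eq by simp
    then have "inner (l t - m) (l' t) = P * (\<theta> * n - e * N\<^sup>2)"
      by (simp add: n_def N_def zt power2_norm_eq_inner inner_diff_right inner_commute)
    then have "a * inner (l t - m) (l' t) = a * (P * (\<theta> * n - e * N\<^sup>2))" by simp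
    also have "\<dots> = P * ((a * \<theta>) * n - a * e * N\<^sup>2)" by (simp add: algebra_simps)
    finally have ll': "a * inner (l t - m) (l' t) = P * (n - a * e * N\<^sup>2)" by (simp add: a\<theta>)
    have "D = (2 * q + s) * (t powr (q - 1) * P) * gap t + Q * P * (\<gamma> (x' t) + C * U)
      + inner (w t) w' + a * \<kappa> * norm (w t) + a * (\<alpha> - a) * (i + \<kappa> * U)
      + a * inner (l t - m) (l' t) + a * \<kappa> * N"
      unfolding D_def pw i_def by (simp add: field_simps)
    \<comment> \<open>Three cancellations take place: the terms in \<open>\<gamma> (x' t)\<close>,
      the coupling \<open>n\<close>, and \<open>a * (\<alpha> - a) * i\<close>.\<close>
    also have "\<dots> = (2 * q + s) * (t powr (q - 1) * (P * gap t)) - a * P * \<gamma> (x t - y)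
      - (\<alpha> - a) * Q * V\<^sup>2 + \<rho> * (a * i + Q * V\<^sup>2) + Q * P * (C * U)
      + a * \<kappa> * norm (w t) + a * (\<alpha> - a) * \<kappa> * U - a * (e * P) * N\<^sup>2 + a * \<kappa> * N"
      unfolding ww' ll' by (simp add: algebra_simps)
    also have "\<dots> \<le> \<bar>2 * q + s\<bar> * (t powr (q - 1) * (P * gap t)) - a * P * (gap t + e / 2 * U\<^sup>2)
      - (\<alpha> - a) * Q * V\<^sup>2 + \<rho> * (a * U * V + Q * V\<^sup>2) + Q * P * (C * U)
      + a * \<kappa> * (a * U + Q * V) + a * (\<alpha> - a) * \<kappa> * U - a * (e * P) * N\<^sup>2 + a * \<kappa> * N"
    proof -
      have "(2 * q + s) * (t powr (q - 1) * (P * gap t)) \<le> \<bar>2 * q + s\<bar> * (t powr (q - 1) * (P * gap t))"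
        using gap_nonneg[OF tp(2)] pos by (intro mult_right_mono) auto
      moreover have "a * P * (gap t + e / 2 * U\<^sup>2) \<le> a * P * \<gamma> (x t - y)"
        using \<gamma>_gap a pos by (intro mult_left_mono) auto
      moreover have "\<rho> * (a * i + Q * V\<^sup>2) \<le> \<rho> * (a * U * V + Q * V\<^sup>2)"
      proof -
        have "i \<le> U * V" unfolding i_def U_def V_def zt using norm_cauchy_schwarz by simp
        then show ?thesis using a pos by (intro mult_left_mono) (auto simp: mult.assoc)
      qed
      moreover have "a * \<kappa> * norm (w t) \<le> a * \<kappa> * (a * U + Q * V)"
      proof (rule mult_left_mono)
        show "norm (w t) \<le> a * U + Q * V"
          using norm_triangle_ineq[of "a *\<^sub>R (x t - y)" "Q *\<^sub>R x' t"] a pos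
          by (simp add: wt U_def V_def zt)
        show "0 \<le> a * \<kappa>" using a R_nonneg p tp by (simp add: \<kappa>_def)
      qed
      ultimately show ?thesis by linarith
    qed
    also have "\<dots> = (\<bar>2 * q + s\<bar> * t powr (q - 1) - a) * (P * gap t)
      - a / 2 * (e * P) * U\<^sup>2 - a * (e * P) * N\<^sup>2
      - (\<alpha> - a) * Q * V\<^sup>2 + \<rho> * (a * U * V + Q * V\<^sup>2)
      + Q * P * (C * U)
      + a * \<kappa> * (a * U + Q * V) + a * (\<alpha> - a) * \<kappa> * U + a * \<kappa> * N"
      by (simp add: algebra_simps)
    finally show ?thesis
      unfolding pw(4)[symmetric] pw(1)[symmetric] unfolding Q_def P_def \<rho>_def C_def e_def
      by (simp add: mult.assoc)
  qed
  ultimately show ?thesis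
    using \<open>H t = energy t\<close> \<open>\<And>u. t \<le> u \<Longrightarrow> energy u \<le> H u\<close> by blast
qed

end

section \<open>Decay of the energy\<close>

lemma eventually_powr_small:
  fixes C d \<eta> :: real
  assumes "\<eta> < 0" "0 < d"
  shows "\<forall>\<^sub>F t in at_top. C * t powr \<eta> \<le> d"
proof -
  have "((\<lambda>t. t powr \<eta>) \<longlongrightarrow> 0) at_top"
    using tendsto_neg_powr[OF assms(1) filterlim_ident] by simp
  then have "((\<lambda>t. C * t powr \<eta>) \<longlongrightarrow> C * 0) at_top" by (intro tendsto_intros)
  then have "\<forall>\<^sub>F t in at_top. C * t powr \<eta> < d"
    using assms(2) by (intro order_tendstoD(2)) auto
  then show ?thesis by (rule eventually_mono) simp
qed

text \<open>Half of each negative square pays for the perturbations. Young's inequality costs one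
  \<open>\<delta>\<close> per variable, and \<open>y1\<close> and \<open>y3\<close> carry a further
  explicit one; hence \<open>4 * \<delta>\<close> for these and \<open>2 * \<delta>\<close> for
  \<open>y2\<close>.\<close>

lemma quadratic_absorb:
  fixes y1 y2 y3 \<sigma> A1 A2 A3 \<delta> K :: real
  assumes "0 < \<delta>" "4 * \<delta> \<le> A1" "2 * \<delta> \<le> A2" "4 * \<delta> \<le> A3"
  shows "- A1 * y1\<^sup>2 - A2 * y2\<^sup>2 - A3 * y3\<^sup>2 + \<delta> * (y1\<^sup>2 + y3\<^sup>2) + K * \<sigma> * (y1 + y2 + y3)
    \<le> - (A1 / 2) * y1\<^sup>2 - (A2 / 2) * y2\<^sup>2 - (A3 / 2) * y3\<^sup>2 + 3 * K\<^sup>2 / (4 * \<delta>) * \<sigma>\<^sup>2"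
proof -
  have young: "K * \<sigma> * y \<le> \<delta> * y\<^sup>2 + K\<^sup>2 / (4 * \<delta>) * \<sigma>\<^sup>2" for y
  proof -
    have "0 \<le> (2 * \<delta> * y - K * \<sigma>)\<^sup>2 / (4 * \<delta>)" using assms by simp
    also have "\<dots> = \<delta> * y\<^sup>2 - K * \<sigma> * y + K\<^sup>2 / (4 * \<delta>) * \<sigma>\<^sup>2"
      using assms by (simp add: power2_eq_square field_simps)
    finally show ?thesis by simp
  qed
  have "2 * \<delta> * y1\<^sup>2 \<le> A1 / 2 * y1\<^sup>2" "\<delta> * y2\<^sup>2 \<le> A2 / 2 * y2\<^sup>2" "2 * \<delta> * y3\<^sup>2 \<le> A3 / 2 * y3\<^sup>2"
    using assms by (intro mult_right_mono; simp)+
  moreover have "3 * K\<^sup>2 / (4 * \<delta>) * \<sigma>\<^sup>2 = 3 * (K\<^sup>2 / (4 * \<delta>) * \<sigma>\<^sup>2)" by simp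
  ultimately show ?thesis using young[of y1] young[of y2] young[of y3] by (simp add: distrib_left)
qed

lemma norm_add_sq_half_le:
  fixes v w :: "'a::real_inner"
  shows "(norm (v + w))\<^sup>2 / 2 \<le> (norm v)\<^sup>2 + (norm w)\<^sup>2"
  using inner_ge_zero[of "v - w"] unfolding power2_norm_eq_inner
  by (simp add: inner_simps inner_commute field_simps)

section \<open>The differential inequality and its integration\<close>

context primal_dual_flow begin

text \<open>Splitting the mixed square lets every term of the energy be compared with one
  dissipation term.\<close>

lemma energy_upper:
  assumes t: "t0 \<le> t"
  shows "energy t \<le> t powr (2 * q + s) * gap t + (a\<^sup>2 + a * (\<alpha> - a) / 2) * (norm (x t - fst (z t)))\<^sup>2
    + t powr (2 * q) * (norm (x' t))\<^sup>2 + a / 2 * (norm (l t - snd (z t)))\<^sup>2"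
proof -
  let ?u = "a *\<^sub>R (x t - fst (z t))" and ?v = "t powr q *\<^sub>R x' t"
  have "(norm (?u + ?v))\<^sup>2 / 2 \<le> (norm ?u)\<^sup>2 + (norm ?v)\<^sup>2" by (rule norm_add_sq_half_le)
  also have "\<dots> = a\<^sup>2 * (norm (x t - fst (z t)))\<^sup>2 + t powr (2 * q) * (norm (x' t))\<^sup>2"
    using a t t0 by (simp add: power_mult_distrib powr_power mult.commute)
  finally show ?thesis unfolding energy_def by (simp add: distrib_right)
qed

text \<open>The bounds on \<open>r\<close> compare the energy weights with the dissipation weights.
  The bounds on \<open>k\<close> are the outcome of Young's inequality on the three kinds of drift:
  \<open>t powr - 1\<close> acting on \<open>U\<close> and \<open>N\<close>,
  \<open>t powr (q - 1)\<close> on the velocity, and \<open>t powr (2 * q + s - 1)\<close> on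
  \<open>U\<close>, the last coming from the gap.\<close>

lemma dissipation:
  assumes sp: "p - 2 < s" and r: "q \<le> r" "p - q - s \<le> r"
    and k: "p - q - s - 2 \<le> - k - r" "q - 2 \<le> - k - r" "3 * q + s + p - 2 \<le> - k - r"
  shows "\<exists>\<mu>>0. \<exists>K\<ge>0. \<exists>T>t0. \<forall>t\<ge>T. \<exists>H D. (H has_real_derivative D) (at t) \<and> H t = energy t \<and>
    (\<forall>u\<ge>t. energy u \<le> H u) \<and> D \<le> - \<mu> * t powr - r * energy t + K * t powr (- k - r)"
proof -
  define \<beta> where "\<beta> = \<alpha> - a"
  have \<beta>: "0 < \<beta>" using a by (simp add: \<beta>_def)
  \<comment> \<open>Chosen for absorption with the coefficients \<open>a * c / 2\<close>,
    \<open>a * c\<close> and \<open>3 * \<beta> / 4\<close>. A quarter of the friction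
    \<open>\<beta>\<close> is reserved for the derivative of \<open>t powr q\<close>.\<close>
  define \<delta> where "\<delta> = min (a * c / 8) (\<beta> / 8)"
  have "0 < a * c" "0 < \<delta>" "\<delta> \<le> a * c / 8" "\<delta> \<le> \<beta> / 8"
    using a c \<beta> by (auto simp: \<delta>_def)
  then have \<delta>: "0 < \<delta>" "4 * \<delta> \<le> a * c / 2" "2 * \<delta> \<le> a * c" "4 * \<delta> \<le> 3 * \<beta> / 4"
    using \<beta> by linarith+
  define \<eta> where "\<eta> = (q + s - p) / 2"
  define K2 where "K2 = R * p * (onorm A + c) + a * (a * (R * p)) + a * \<beta> * (R * p) + a * (R * p)"
  have K2: "R * p * (onorm A + c) + a * (a * (R * p)) + a * \<beta> * (R * p) \<le> K2" "a * (R * p) \<le> K2" "0 \<le> K2"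
    using R_nonneg p a \<beta> c onorm_pos_le[OF A] by (auto simp: K2_def)
  define a2 where "a2 = a\<^sup>2 + a * \<beta> / 2"
  define B where "B = (a * c / 4) / a2"
  \<comment> \<open>Each entry divides what absorption leaves by the matching coefficient in
    \<open>energy_upper\<close>: \<open>a / 2\<close> for the gap, \<open>B\<close> for
    \<open>U\<^sup>2\<close>, \<open>c\<close> for \<open>N\<^sup>2\<close> and
    \<open>3 * \<beta> / 8\<close> for the velocity.\<close>
  define \<mu> where "\<mu> = min (min (a / 2) B) (min c (3 * \<beta> / 8))"
  have apos: "0 < a2" using a \<beta> by (simp add: a2_def add_pos_pos)
  have "0 < B" using apos a c by (simp add: B_def)
  then have \<mu>: "0 < \<mu>" "\<mu> \<le> a / 2" "\<mu> \<le> c" "\<mu> \<le> 3 * \<beta> / 8" "\<mu> \<le> B"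
    using a c \<beta> by (auto simp: \<mu>_def min_def)
  have \<mu>2: "\<mu> * a2 \<le> a * c / 4" using \<mu>(5) apos by (simp only: pos_le_divide_eq B_def)
  define K where "K = 3 * K2\<^sup>2 / (4 * \<delta>)"
  have "0 \<le> K" using \<delta> by (simp add: K_def)
  \<comment> \<open>The last exponent is negative precisely when \<open>p - 2 < s\<close>; it
    subordinates the cross term in \<open>U\<close> and \<open>V\<close> to the two dissipated
    squares.\<close>
  have "\<forall>\<^sub>F t in at_top. 1 \<le> t \<and> t0 < t \<and> \<bar>2 * q + s\<bar> * t powr (q - 1) \<le> a / 2
      \<and> q * t powr (q - 1) \<le> \<beta> / 4 \<and> (a * q) * t powr (q / 2 - 1 - \<eta>) \<le> 2 * \<delta>"
    using q a \<beta> \<delta> sp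
    by (intro eventually_conj eventually_ge_at_top eventually_gt_at_top eventually_powr_small)
      (auto simp: \<eta>_def field_simps)
  then obtain T where T: "\<And>t. t \<ge> T \<Longrightarrow> 1 \<le> t" "\<And>t. t \<ge> T \<Longrightarrow> t0 < t"
      "\<And>t. t \<ge> T \<Longrightarrow> \<bar>2 * q + s\<bar> * t powr (q - 1) \<le> a / 2" "\<And>t. t \<ge> T \<Longrightarrow> q * t powr (q - 1) \<le> \<beta> / 4"
      "\<And>t. t \<ge> T \<Longrightarrow> (a * q) * t powr (q / 2 - 1 - \<eta>) \<le> 2 * \<delta>"
    unfolding eventually_at_top_linorder by blast
  have main: "\<exists>H D. (H has_real_derivative D) (at t) \<and> H t = energy t \<and>
    (\<forall>u\<ge>t. energy u \<le> H u) \<and> D \<le> - \<mu> * t powr - r * energy t + K * t powr (- k - r)" if "T \<le> t" for t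
  proof -
    have t: "1 \<le> t" "t0 < t" "0 < t" using T that by force+
    define \<kappa> where "\<kappa> = R * p / t"
    define U where "U = norm (x t - fst (z t))"
    define N where "N = norm (l t - snd (z t))"
    define V where "V = norm (x' t)"
    define y0 where "y0 = t powr (q + s) * gap t"
    define y1 where "y1 = t powr \<eta> * U"
    define y2 where "y2 = t powr \<eta> * N"
    define y3 where "y3 = t powr (q / 2) * V"
    define \<sigma> where "\<sigma> = t powr (- (k + r) / 2)"
    have nn: "0 \<le> U" "0 \<le> N" "0 \<le> V" "0 \<le> y0" "0 \<le> y1" "0 \<le> y2" "0 \<le> y3" "0 \<le> \<sigma>"
      using gap_nonneg[of t] t by (auto simp: U_def N_def V_def y0_def y1_def y2_def y3_def \<sigma>_def)
    have "(t powr \<zeta>)\<^sup>2 = t powr (2 * \<zeta>)" for \<zeta> by (simp add: power2_eq_square flip: powr_add)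
    moreover have "2 * \<eta> = q + s - p" "2 * (q / 2) = q" "2 * (- (k + r) / 2) = - k - r"
      by (simp_all add: \<eta>_def)
    ultimately have sq: "y1\<^sup>2 = t powr (q + s - p) * U\<^sup>2" "y2\<^sup>2 = t powr (q + s - p) * N\<^sup>2" "y3\<^sup>2 = t powr q * V\<^sup>2"
      "\<sigma>\<^sup>2 = t powr (- k - r)"
      by (simp_all only: y1_def y2_def y3_def \<sigma>_def power_mult_distrib)
    obtain H D where H: "(H has_real_derivative D) (at t)" "H t = energy t" "\<forall>u\<ge>t. energy u \<le> H u"
      and D: "D \<le> (\<bar>2 * q + s\<bar> * t powr (q - 1) - a) * y0
      - a * c / 2 * t powr (q + s - p) * U\<^sup>2 - a * c * t powr (q + s - p) * N\<^sup>2
      - (\<alpha> - a) * t powr q * V\<^sup>2 + q * t powr (q - 1) * (a * U * V + t powr q * V\<^sup>2)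
      + t powr (2 * q + s) * (\<kappa> * (onorm A + ep t) * U)
      + a * \<kappa> * (a * U + t powr q * V) + a * (\<alpha> - a) * \<kappa> * U + a * \<kappa> * N"
      using energy_majorant[OF t(2)] unfolding U_def N_def V_def \<kappa>_def y0_def by blast
    have e0: "(\<bar>2 * q + s\<bar> * t powr (q - 1) - a) * y0 \<le> - (a / 2) * y0"
      using T(3)[OF that] nn by (intro mult_right_mono) auto
    have e1: "q * t powr (q - 1) * (a * U * V + t powr q * V\<^sup>2) \<le> \<delta> * (y1\<^sup>2 + y3\<^sup>2) + \<beta> / 4 * y3\<^sup>2"
    proof -
      have "t powr (q - 1) = t powr (q / 2 - 1 - \<eta>) * (t powr \<eta> * t powr (q / 2))"
        by (simp add: powr_add[symmetric])
      then have "q * t powr (q - 1) * (a * U * V) = ((a * q) * t powr (q / 2 - 1 - \<eta>)) * (y1 * y3)"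
        by (simp add: y1_def y3_def mult_ac)
      also have "\<dots> \<le> (2 * \<delta>) * (y1 * y3)" using T(5)[OF that] nn by (intro mult_right_mono) auto
      also have "\<dots> \<le> \<delta> * (y1\<^sup>2 + y3\<^sup>2)"
        using \<delta> mult_left_mono[OF sum_squares_bound[of y1 y3], of \<delta>] by (simp add: mult_ac)
      finally have "q * t powr (q - 1) * (a * U * V) \<le> \<delta> * (y1\<^sup>2 + y3\<^sup>2)" .
      moreover have "q * t powr (q - 1) * (t powr q * V\<^sup>2) \<le> \<beta> / 4 * y3\<^sup>2"
        unfolding sq(3) using T(4)[OF that] by (rule mult_right_mono) auto
      ultimately show ?thesis by (simp add: distrib_left)
    qed
    \<comment> \<open>Every drift term becomes \<open>\<sigma>\<close> times a normalized variable.
      With the pairs \<open>(2 * q + s, \<eta>)\<close>, \<open>(0, \<eta>)\<close> and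
      \<open>(q, q / 2)\<close> for \<open>\<epsilon>\<close> and \<open>\<zeta>\<close>, the
      premise is, after doubling, one of the three assumptions on \<open>k\<close>.\<close>
    have pw: "t powr \<epsilon> * (t powr -1 * W) \<le> \<sigma> * (t powr \<zeta> * W)" if "\<epsilon> - 1 - \<zeta> \<le> - (k + r) / 2" "0 \<le> W" for \<epsilon> \<zeta> W
    proof -
      have "t powr (\<epsilon> - 1 - \<zeta>) * (t powr \<zeta> * W) \<le> \<sigma> * (t powr \<zeta> * W)"
        unfolding \<sigma>_def using that t by (intro mult_right_mono powr_mono) auto
      moreover have "t powr (\<epsilon> - 1 - \<zeta>) * (t powr \<zeta> * W) = t powr \<epsilon> * (t powr -1 * W)"
        unfolding mult.assoc[symmetric] powr_add[symmetric] by simp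
      ultimately show ?thesis by simp
    qed
    have \<kappa>: "\<kappa> = R * p * t powr - 1" using t by (simp add: \<kappa>_def powr_minus_divide)
    have Rp: "0 \<le> R * p" using R_nonneg p by simp
    have e2: "t powr (2 * q + s) * (\<kappa> * (onorm A + ep t) * U) \<le> R * p * (onorm A + c) * (\<sigma> * y1)"
    proof -
      have "1 \<le> t powr p" using t p by (simp add: ge_one_powr_ge_zero)
      then have "ep t \<le> c" using c by (simp add: ep_def divide_le_eq)
      have *: "t powr (2 * q + s) * (t powr -1 * U) \<le> \<sigma> * y1"
        unfolding y1_def by (rule pw) (use k nn in \<open>auto simp: \<eta>_def field_simps\<close>)
      have "t powr (2 * q + s) * (\<kappa> * (onorm A + ep t) * U)
          = R * p * (onorm A + ep t) * (t powr (2 * q + s) * (t powr -1 * U))" by (simp add: \<kappa>)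
      also have "\<dots> \<le> R * p * (onorm A + c) * (\<sigma> * y1)"
      proof (rule mult_mono[OF _ *])
        show "R * p * (onorm A + ep t) \<le> R * p * (onorm A + c)"
          using \<open>ep t \<le> c\<close> Rp by (intro mult_left_mono) auto
        show "0 \<le> R * p * (onorm A + c)"
          using Rp onorm_pos_le[OF A] c by (intro mult_nonneg_nonneg[OF Rp]) auto
        show "0 \<le> t powr (2 * q + s) * (t powr -1 * U)" using nn by (intro mult_nonneg_nonneg) auto
      qed
      finally show ?thesis .
    qed
    have e3: "a * \<kappa> * (a * U + t powr q * V) + a * (\<alpha> - a) * \<kappa> * U + a * \<kappa> * N
      \<le> (a * (a * (R * p)) + a * \<beta> * (R * p)) * (\<sigma> * y1) + a * (R * p) * (\<sigma> * y3) + a * (R * p) * (\<sigma> * y2)"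
    proof -
      have 1: "t powr -1 * U \<le> \<sigma> * y1" "t powr -1 * N \<le> \<sigma> * y2"
        using pw[of 0 \<eta> U] pw[of 0 \<eta> N] k nn t by (auto simp: \<eta>_def y1_def y2_def field_simps)
      have 3: "t powr q * (t powr -1 * V) \<le> \<sigma> * y3"
        unfolding y3_def by (rule pw) (use k nn in \<open>auto simp: field_simps\<close>)
      have "a * \<kappa> * (a * U + t powr q * V) + a * (\<alpha> - a) * \<kappa> * U + a * \<kappa> * N
        = (a * (a * (R * p)) + a * \<beta> * (R * p)) * (t powr -1 * U)
          + a * (R * p) * (t powr q * (t powr -1 * V)) + a * (R * p) * (t powr -1 * N)"
        by (simp add: \<kappa> \<beta>_def algebra_simps)
      also have "\<dots> \<le> (a * (a * (R * p)) + a * \<beta> * (R * p)) * (\<sigma> * y1)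
          + a * (R * p) * (\<sigma> * y3) + a * (R * p) * (\<sigma> * y2)"
        using 1 3 a \<beta> Rp by (intro add_mono mult_left_mono) auto
      finally show ?thesis .
    qed
    have e4: "t powr (2 * q + s) * (\<kappa> * (onorm A + ep t) * U)
      + (a * \<kappa> * (a * U + t powr q * V) + a * (\<alpha> - a) * \<kappa> * U + a * \<kappa> * N) \<le> K2 * \<sigma> * (y1 + y2 + y3)"
    proof -
      have "(R * p * (onorm A + c) + a * (a * (R * p)) + a * \<beta> * (R * p)) * (\<sigma> * y1) \<le> K2 * (\<sigma> * y1)"
        "a * (R * p) * (\<sigma> * y3) \<le> K2 * (\<sigma> * y3)" "a * (R * p) * (\<sigma> * y2) \<le> K2 * (\<sigma> * y2)"
        using K2 nn by (intro mult_right_mono; simp)+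
      then show ?thesis using e2 e3 by (simp add: algebra_simps)
    qed
    have "D \<le> - (a / 2) * y0 + (- (a * c / 2) * y1\<^sup>2 - (a * c) * y2\<^sup>2 - (3 * \<beta> / 4) * y3\<^sup>2
      + \<delta> * (y1\<^sup>2 + y3\<^sup>2) + K2 * \<sigma> * (y1 + y2 + y3))"
    proof -
      have "a * c / 2 * t powr (q + s - p) * U\<^sup>2 = a * c / 2 * y1\<^sup>2"
        "a * c * t powr (q + s - p) * N\<^sup>2 = a * c * y2\<^sup>2" "(\<alpha> - a) * t powr q * V\<^sup>2 = \<beta> * y3\<^sup>2"
        by (simp_all add: sq \<beta>_def)
      moreover have "\<beta> * y3\<^sup>2 = \<beta> / 4 * y3\<^sup>2 + (3 * \<beta> / 4) * y3\<^sup>2" by (simp add: field_simps)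
      ultimately show ?thesis using D e0 e1 e4 by linarith
    qed
    also have "\<dots> \<le> - (a / 2) * y0 + (- ((a * c / 2) / 2) * y1\<^sup>2 - ((a * c) / 2) * y2\<^sup>2 - ((3 * \<beta> / 4) / 2) * y3\<^sup>2
      + K * \<sigma>\<^sup>2)"
      unfolding K_def by (intro add_left_mono quadratic_absorb \<delta>)
    also have "\<dots> \<le> - \<mu> * t powr - r * energy t + K * \<sigma>\<^sup>2"
    proof -
      have "t powr - r * energy t \<le> t powr - r * (t powr (2 * q + s) * gap t + a2 * U\<^sup>2
          + t powr (2 * q) * V\<^sup>2 + a / 2 * N\<^sup>2)"
        using energy_upper[of t] t by (intro mult_left_mono) (auto simp: U_def V_def N_def a2_def \<beta>_def)
      also have "\<dots> = t powr (2 * q + s - r) * gap t + a2 * (t powr - r * U\<^sup>2)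
          + t powr (2 * q - r) * V\<^sup>2 + a / 2 * (t powr - r * N\<^sup>2)"
        by (simp add: distrib_left powr_diff powr_minus_divide)
      also have "\<dots> \<le> y0 + a2 * y1\<^sup>2 + y3\<^sup>2 + a / 2 * y2\<^sup>2"
        unfolding y0_def sq using t r a apos gap_nonneg[of t]
        by (intro add_mono mult_left_mono mult_right_mono powr_mono) auto
      finally have "\<mu> * (t powr - r * energy t) \<le> \<mu> * (y0 + a2 * y1\<^sup>2 + y3\<^sup>2 + a / 2 * y2\<^sup>2)"
        using \<mu> by (intro mult_left_mono) auto
      also have "\<dots> = \<mu> * y0 + \<mu> * a2 * y1\<^sup>2 + \<mu> * y3\<^sup>2 + \<mu> * a / 2 * y2\<^sup>2"
        by (simp add: algebra_simps)
      also have "\<dots> \<le> a / 2 * y0 + a * c / 4 * y1\<^sup>2 + 3 * \<beta> / 8 * y3\<^sup>2 + c * a / 2 * y2\<^sup>2"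
        using \<mu> \<mu>2 nn a by (intro add_mono mult_right_mono divide_right_mono) auto
      finally show ?thesis by (simp add: mult_ac)
    qed
    finally have "D \<le> - \<mu> * t powr - r * energy t + K * t powr (- k - r)" by (simp add: sq)
    then show ?thesis using H by blast
  qed
  have "t0 < max T (t0 + 1)" "\<forall>t\<ge>max T (t0 + 1). T \<le> t" by auto
  then show ?thesis using \<mu>(1) \<open>0 \<le> K\<close> main by blast
qed

text \<open>A barrier for \<open>t powr k * energy t\<close>. At contact the forcing is a small part
  of the damping once \<open>M\<close> is large against \<open>K / \<mu>\<close>, and the growth of
  \<open>t powr k\<close> costs only \<open>k / t\<close> relative to the energy, which
  \<open>r < 1\<close> makes negligible against \<open>t powr - r\<close>.\<close>

lemma energy_decay:
  assumes sp: "p - 2 < s" and r: "q \<le> r" "p - q - s \<le> r" "r < 1"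
    and k: "p - q - s - 2 \<le> - k - r" "q - 2 \<le> - k - r" "3 * q + s + p - 2 \<le> - k - r"
  shows "\<exists>M>0. \<exists>T>t0. \<forall>t\<ge>T. 1 \<le> t \<and> energy t \<le> M * t powr - k"
proof -
  obtain \<mu> K T0 where \<mu>: "\<mu> > 0" and K: "K \<ge> 0" and T0: "T0 > t0"
    and H: "\<And>t. t \<ge> T0 \<Longrightarrow> \<exists>H D. (H has_real_derivative D) (at t) \<and> H t = energy t \<and>
    (\<forall>u\<ge>t. energy u \<le> H u) \<and> D \<le> - \<mu> * t powr - r * energy t + K * t powr (- k - r)"
    using dissipation[OF sp r(1,2) k] by blast
  have "\<forall>\<^sub>F t in at_top. 1 \<le> t \<and> T0 \<le> t \<and> k * t powr (r - 1) \<le> \<mu> / 4"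
    using r \<mu> by (intro eventually_conj eventually_ge_at_top eventually_powr_small) auto
  then obtain T where T: "\<And>t. t \<ge> T \<Longrightarrow> 1 \<le> t" "\<And>t. t \<ge> T \<Longrightarrow> T0 \<le> t"
      "\<And>t. t \<ge> T \<Longrightarrow> k * t powr (r - 1) \<le> \<mu> / 4"
    unfolding eventually_at_top_linorder by blast
  have Tt0: "T > t0" using T(2)[of T] T0 by simp
  define F where "F t = t powr k * energy t" for t
  \<comment> \<open>The bound \<open>4 * K / \<mu>\<close> limits the forcing to a quarter of the
    damping; the added 1 makes \<open>M\<close> positive, so that the derivative at contact is
    strictly negative.\<close>
  define M where "M = max (F T) (4 * K / \<mu>) + 1"
  have "0 \<le> 4 * K / \<mu>" using K \<mu> by simp
  then have M: "0 < M" "F T \<le> M" "4 * K / \<mu> \<le> M" unfolding M_def by linarith+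
  have "F t \<le> M" if "T \<le> t" for t
  proof (rule barrier_le[where F = F and M = M and T = T, OF _ M(2) _ that])
    have "0 < u" if "u \<in> {T..}" for u using T(1)[of u] that by auto
    then show "continuous_on {T..} F"
      unfolding F_def by (intro continuous_intros energy_continuous Tt0) auto
    fix t assume t: "T \<le> t" and FM: "F t = M"
    have tp: "1 \<le> t" "0 < t" using T(1)[OF t] by auto
    obtain H D where HD: "(H has_real_derivative D) (at t)" "H t = energy t" "\<forall>u\<ge>t. energy u \<le> H u"
      and D: "D \<le> - \<mu> * t powr - r * energy t + K * t powr (- k - r)"
      using H[OF T(2)[OF t]] by blast
    define G where "G = t powr - r * energy t"
    have E: "energy t = M * t powr - k" using FM tp by (simp add: F_def powr_minus_divide field_simps)
    have "G > 0" using tp M by (simp add: G_def E)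
    have "K * t powr (- k - r) \<le> \<mu> / 4 * G"
    proof -
      have "K \<le> \<mu> / 4 * M" using M(3) \<mu> by (simp add: field_simps)
      then have "K * t powr (- k - r) \<le> (\<mu> / 4 * M) * t powr (- k - r)" by (rule mult_right_mono) simp
      also have "\<dots> = \<mu> / 4 * G"
      proof -
        have "- k - r = - r + - k" by simp
        then show ?thesis by (simp only: G_def E powr_add mult_ac)
      qed
      finally show ?thesis .
    qed
    moreover have "k * t powr - 1 * energy t \<le> \<mu> / 4 * G"
    proof -
      have "k * t powr - 1 * energy t = (k * t powr (r - 1)) * G"
        using tp by (simp add: G_def powr_diff powr_minus_divide)
      also have "\<dots> \<le> \<mu> / 4 * G" using T(3)[OF t] \<open>G > 0\<close> by (intro mult_right_mono) auto
      finally show ?thesis .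
    qed
    moreover have "D \<le> - (\<mu> * G) + K * t powr (- k - r)" using D by (simp add: G_def mult.assoc)
    ultimately have "k * t powr - 1 * energy t + D \<le> - (\<mu> / 2) * G" by linarith
    also have "\<dots> < 0" using \<mu> \<open>G > 0\<close> by simp
    finally have neg: "k * t powr - 1 * energy t + D < 0" .
    have "((\<lambda>u. u powr k * H u) has_real_derivative k * t powr (k - 1) * H t + D * t powr k) (at t)"
      using tp by (intro DERIV_mult HD(1)) (auto intro!: derivative_eq_intros)
    then have "((\<lambda>u. u powr k * H u) has_real_derivative t powr k * (k * t powr - 1 * energy t + D)) (at t)"
    proof (rule DERIV_cong)
      show "k * t powr (k - 1) * H t + D * t powr k = t powr k * (k * t powr - 1 * energy t + D)"
        using tp by (simp add: HD(2) powr_diff powr_minus_divide algebra_simps)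
    qed
    moreover have "t powr k * (k * t powr - 1 * energy t + D) < 0" using neg tp by (simp add: mult_pos_neg)
    moreover have "t powr k * H t = M" using FM by (simp add: HD(2) F_def)
    moreover have "\<forall>u\<ge>t. F u \<le> u powr k * H u" unfolding F_def using HD(3) by (simp add: mult_left_mono)
    ultimately show "\<exists>H D. (H has_real_derivative D) (at t) \<and> D < 0 \<and> H t = M \<and> (\<forall>u\<ge>t. F u \<le> H u)"
      by (intro exI[of _ "\<lambda>u. u powr k * H u"] exI[of _ "t powr k * (k * t powr - 1 * energy t + D)"] conjI)
  qed
  moreover have "energy t = F t * t powr - k" if "T \<le> t" for t
    using T(1)[OF that] by (simp add: F_def powr_minus_divide)
  ultimately have "\<forall>t\<ge>T. 1 \<le> t \<and> energy t \<le> M * t powr - k"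
    using T(1) by (simp add: mult_right_mono)
  then show ?thesis using M(1) Tt0 by blast
qed

end

section \<open>Convergence rates\<close>

lemma le_bigOI:
  assumes "\<And>t. T \<le> t \<Longrightarrow> g t \<le> C * h t" "\<And>t. T \<le> t \<Longrightarrow> 0 \<le> h t"
  shows "le_bigO t0 g h"
  unfolding le_bigO_def
proof (intro exI conjI allI impI)
  fix t assume "max T t0 \<le> t"
  then have "g t \<le> C * h t" "C * h t \<le> (\<bar>C\<bar> + 1) * h t" using assms by (auto intro!: mult_right_mono)
  then show "g t \<le> (\<bar>C\<bar> + 1) * h t" by simp
qed auto

section \<open>From the energy to the individual quantities\<close>

context primal_dual_flow begin

lemma energy_lower:
  assumes t: "t0 \<le> t"
  shows "t powr (2 * q + s) * gap t \<le> energy t"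
    and "a * (\<alpha> - a) / 2 * (norm (x t - fst (z t)))\<^sup>2 \<le> energy t"
    and "a / 2 * (norm (l t - snd (z t)))\<^sup>2 \<le> energy t"
    and "t powr (2 * q) * (norm (x' t))\<^sup>2 \<le> 4 * (1 + a / (\<alpha> - a)) * energy t"
proof -
  define u where "u = x t - fst (z t)"
  define w where "w = a *\<^sub>R u + t powr q *\<^sub>R x' t"
  have E: "energy t = t powr (2 * q + s) * gap t + (norm w)\<^sup>2 / 2
    + a * (\<alpha> - a) / 2 * (norm u)\<^sup>2 + a / 2 * (norm (l t - snd (z t)))\<^sup>2"
    by (simp add: energy_def w_def u_def)
  have nn: "0 \<le> t powr (2 * q + s) * gap t" "0 \<le> (norm w)\<^sup>2 / 2" "0 \<le> a * (\<alpha> - a) / 2 * (norm u)\<^sup>2"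
    "0 \<le> a / 2 * (norm (l t - snd (z t)))\<^sup>2"
    using gap_nonneg[OF t] a by auto
  show "t powr (2 * q + s) * gap t \<le> energy t"
    "a / 2 * (norm (l t - snd (z t)))\<^sup>2 \<le> energy t"
    using nn E by linarith+
  have 1: "a * (\<alpha> - a) / 2 * (norm u)\<^sup>2 \<le> energy t" using nn E by linarith
  then show "a * (\<alpha> - a) / 2 * (norm (x t - fst (z t)))\<^sup>2 \<le> energy t" by (simp add: u_def)
  \<comment> \<open>The velocity is recovered as \<open>w - a *\<^sub>R u\<close>; the constant
    \<open>4 * (a / (\<alpha> - a))\<close> rewrites \<open>2 * a\<^sup>2\<close> in terms of the
    weight of \<open>u\<close> in the energy.\<close>
  have "t powr (2 * q) * (norm (x' t))\<^sup>2 = (norm (w + (- a) *\<^sub>R u))\<^sup>2"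
    using t t0 by (simp add: w_def power_mult_distrib powr_power mult.commute)
  also have "\<dots> \<le> 2 * ((norm w)\<^sup>2 + (norm ((- a) *\<^sub>R u))\<^sup>2)"
    using norm_add_sq_half_le[of w "(- a) *\<^sub>R u"]
    by (simp only: pos_divide_le_eq zero_less_numeral mult.commute)
  also have "\<dots> = 4 * ((norm w)\<^sup>2 / 2) + 4 * (a / (\<alpha> - a)) * (a * (\<alpha> - a) / 2 * (norm u)\<^sup>2)"
    using a by (simp add: power_mult_distrib power2_eq_square)
  also have "\<dots> \<le> 4 * energy t + 4 * (a / (\<alpha> - a)) * energy t"
  proof (rule add_mono)
    have "(norm w)\<^sup>2 / 2 \<le> energy t" using nn E by linarith
    then show "4 * ((norm w)\<^sup>2 / 2) \<le> 4 * energy t" by simp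
    show "4 * (a / (\<alpha> - a)) * (a * (\<alpha> - a) / 2 * (norm u)\<^sup>2) \<le> 4 * (a / (\<alpha> - a)) * energy t"
      using 1 a by (intro mult_left_mono) auto
  qed
  finally show "t powr (2 * q) * (norm (x' t))\<^sup>2 \<le> 4 * (1 + a / (\<alpha> - a)) * energy t"
    by (simp add: algebra_simps)
qed

text \<open>The regularized saddle point itself violates the constraint by \<open>ep t\<close> times
  its multiplier. This bias is the origin of the term \<open>1 / t powr p\<close> in the feasibility
  rate.\<close>

lemma feasibility_le:
  assumes t: "t0 \<le> t"
  shows "norm (A (x t) - b) \<le> onorm A * norm (x t - fst (z t)) + ep t * R"
proof -
  have "A (fst (z t)) - b = ep t *\<^sub>R snd (z t)" using kkt_ep[OF t] by (simp add: kkt_def split_beta)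
  then have "A (x t) - b = A (x t - fst (z t)) + ep t *\<^sub>R snd (z t)" unfolding A_diff by (metis add.commute diff_add_cancel diff_add_eq)
  then have "norm (A (x t) - b) \<le> norm (A (x t - fst (z t))) + ep t * norm (snd (z t))"
    using norm_triangle_ineq[of "A (x t - fst (z t))" "ep t *\<^sub>R snd (z t)"] ep_pos[OF t] by simp
  moreover have "norm (snd (z t)) \<le> R"
    using R[OF t] norm_snd_le[of "snd (z t)" "fst (z t)"] by simp
  then have "ep t * norm (snd (z t)) \<le> ep t * R" using ep_pos[OF t] by (intro mult_left_mono) auto
  ultimately show ?thesis using onorm[OF A, of "x t - fst (z t)"] by linarith
qed

text \<open>The regularized minimality is tested at \<open>xs\<close>, which costs
  \<open>ep t / 2 * (norm xs)\<^sup>2\<close>, and exchanging the multiplier for \<open>ls\<close>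
  costs a multiple of the infeasibility. Removing the multiplier term to isolate \<open>f\<close>
  adds another \<open>norm ls\<close>.\<close>

lemma objective_le:
  assumes t: "t0 \<le> t" and opt: "kkt 0 (xs, ls)"
  shows "reg 0 (x t) ls - reg 0 xs ls \<le> gap t + ep t / 2 * (norm xs)\<^sup>2 + (norm ls + R) * norm (A (x t) - b)"
    and "\<bar>f (x t) - f xs\<bar> \<le> gap t + ep t / 2 * (norm xs)\<^sup>2 + (2 * norm ls + R) * norm (A (x t) - b)"
proof -
  obtain y m where z: "z t = (y, m)" by fastforce
  have feas: "A xs = b" using opt by (simp add: kkt_def)
  have sad: "(y, m) \<in> saddle_points (reg (ep t))" "(xs, ls) \<in> saddle_points (reg 0)"
    using kkt_ep[OF t] ep_pos[OF t] opt by (simp_all add: saddle_points_reg_iff z)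
  have le: "reg (ep t) y m \<le> reg (ep t) xs m" "reg 0 xs ls \<le> reg 0 (x t) ls"
    using sad by (auto simp: saddle_points_def)
  have "inner (ls - m) (A (x t) - b) \<le> (norm ls + R) * norm (A (x t) - b)"
  proof -
    have "norm (ls - m) \<le> norm ls + R"
      using norm_triangle_ineq4[of ls m] R[OF t] norm_snd_le[of m y] by (simp add: z)
    then have "norm (ls - m) * norm (A (x t) - b) \<le> (norm ls + R) * norm (A (x t) - b)"
      by (rule mult_right_mono) simp
    then show ?thesis using norm_cauchy_schwarz[of "ls - m" "A (x t) - b"] by linarith
  qed
  moreover have "0 \<le> ep t / 2 * (norm (x t))\<^sup>2" using ep_pos[OF t] by simp
  ultimately show L: "reg 0 (x t) ls - reg 0 xs ls
      \<le> gap t + ep t / 2 * (norm xs)\<^sup>2 + (norm ls + R) * norm (A (x t) - b)"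
    using le(1) by (simp add: gap_def z reg_def feas inner_diff_left right_diff_distrib)
  have "\<bar>inner ls (A (x t) - b)\<bar> \<le> norm ls * norm (A (x t) - b)" by (rule Cauchy_Schwarz_ineq2)
  moreover have "reg 0 (x t) ls - reg 0 xs ls = f (x t) - f xs + inner ls (A (x t) - b)"
    by (simp add: reg_def feas)
  moreover have "0 \<le> gap t + ep t / 2 * (norm xs)\<^sup>2 + (norm ls + R) * norm (A (x t) - b)"
    using L le(2) by linarith
  ultimately show "\<bar>f (x t) - f xs\<bar> \<le> gap t + ep t / 2 * (norm xs)\<^sup>2 + (2 * norm ls + R) * norm (A (x t) - b)"
    using L le(2) by (simp add: distrib_right)
qed

lemma rates:
  assumes sp: "p - 2 < s" and r: "q \<le> r" "p - q - s \<le> r" "r < 1"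
    and k: "p - q - s - 2 \<le> - k - r" "q - 2 \<le> - k - r" "3 * q + s + p - 2 \<le> - k - r"
  obtains C T where "T > t0" "C > 0" "\<And>t. t \<ge> T \<Longrightarrow> 1 \<le> t"
    "\<And>t. t \<ge> T \<Longrightarrow> (norm (x t - fst (z t)))\<^sup>2 \<le> C * (1 / t powr k)"
    "\<And>t. t \<ge> T \<Longrightarrow> (norm (l t - snd (z t)))\<^sup>2 \<le> C * (1 / t powr k)"
    "\<And>t. t \<ge> T \<Longrightarrow> (norm (x' t))\<^sup>2 \<le> C * (1 / t powr (k + 2 * q))"
    "\<And>t. t \<ge> T \<Longrightarrow> gap t \<le> C * (1 / t powr (k + 2 * q + s))"
proof -
  obtain M T where M: "M > 0" "T > t0" "\<And>t. t \<ge> T \<Longrightarrow> 1 \<le> t"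
    "\<And>t. t \<ge> T \<Longrightarrow> energy t \<le> M * t powr - k"
    using energy_decay[OF sp r k] by blast
  define B where "B = a * (\<alpha> - a) / 2"
  define D where "D = 4 * (1 + a / (\<alpha> - a))"
  have pos: "0 < B" "0 < D" "0 < a / 2" using a by (auto simp: B_def D_def add_pos_nonneg)
  define C where "C = M / B + M / (a / 2) + D * M + M"
  have C: "0 < C" "M / B \<le> C" "M / (a / 2) \<le> C" "D * M \<le> C" "M \<le> C"
  proof -
    have "0 < M / B" "0 < M / (a / 2)" "0 < D * M" using M(1) pos by auto
    then show "0 < C" "M / B \<le> C" "M / (a / 2) \<le> C" "D * M \<le> C" "M \<le> C"
      unfolding C_def using M(1) by linarith+
  qed
  show thesis
  proof (rule that[OF M(2) C(1) M(3)])
    fix t assume t: "t \<ge> T"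
    have tp: "t0 \<le> t" "0 < t" using t M(2) t0 by auto
    note en = energy_lower[OF tp(1)]
    have e: "energy t \<le> M * (1 / t powr k)" using M(4)[OF t] by (simp add: powr_minus_divide)
    have h: "0 \<le> 1 / t powr j" for j by simp
    have "(norm (x t - fst (z t)))\<^sup>2 \<le> (M * (1 / t powr k)) / B"
      using order_trans[OF en(2) e] unfolding B_def[symmetric]
      by (simp only: pos_le_divide_eq[OF pos(1)] mult.commute)
    also have "\<dots> = M / B * (1 / t powr k)" by simp
    also have "\<dots> \<le> C * (1 / t powr k)" by (rule mult_right_mono[OF C(2) h])
    finally show "(norm (x t - fst (z t)))\<^sup>2 \<le> C * (1 / t powr k)" .
    have "(norm (l t - snd (z t)))\<^sup>2 \<le> (M * (1 / t powr k)) / (a / 2)"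
      using order_trans[OF en(3) e] pos(3) by (simp only: pos_le_divide_eq mult.commute)
    also have "\<dots> = M / (a / 2) * (1 / t powr k)" by simp
    also have "\<dots> \<le> C * (1 / t powr k)" by (rule mult_right_mono[OF C(3) h])
    finally show "(norm (l t - snd (z t)))\<^sup>2 \<le> C * (1 / t powr k)" .
    have "t powr (2 * q) * (norm (x' t))\<^sup>2 \<le> D * (M * (1 / t powr k))"
      using en(4) mult_left_mono[OF e, of D] pos(2) by (simp add: D_def)
    also have "\<dots> = D * M * (1 / t powr k)" by simp
    also have "\<dots> \<le> C * (1 / t powr k)" by (rule mult_right_mono[OF C(4) h])
    finally show "(norm (x' t))\<^sup>2 \<le> C * (1 / t powr (k + 2 * q))"
      using tp by (simp add: powr_add field_simps)
    have "t powr (2 * q + s) * gap t \<le> M * (1 / t powr k)" using en(1) e by linarith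
    also have "\<dots> \<le> C * (1 / t powr k)" by (rule mult_right_mono[OF C(5) h])
    finally show "gap t \<le> C * (1 / t powr (k + 2 * q + s))"
      using tp by (simp add: powr_add field_simps)
  qed
qed

text \<open>The free exponent \<open>m\<close> serves both regimes: objective errors combine the
  infeasibility, of order \<open>k / 2\<close> up to the bias, with the gap, of order
  \<open>k + 2 * q + s\<close>, and either may be the slower.\<close>

lemma bigO_rates:
  assumes sp: "p - 2 < s" and r: "q \<le> r" "p - q - s \<le> r" "r < 1"
    and k: "p - q - s - 2 \<le> - k - r" "q - 2 \<le> - k - r" "3 * q + s + p - 2 \<le> - k - r"
  shows "le_bigO t0 (\<lambda>t. (norm (x t - fst (z t)))\<^sup>2) (\<lambda>t. 1 / t powr k) \<and>
    le_bigO t0 (\<lambda>t. (norm (l t - snd (z t)))\<^sup>2) (\<lambda>t. 1 / t powr k) \<and>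
    le_bigO t0 (\<lambda>t. (norm (x' t))\<^sup>2) (\<lambda>t. 1 / t powr (k + 2 * q)) \<and>
    le_bigO t0 gap (\<lambda>t. 1 / t powr (k + 2 * q + s)) \<and>
    le_bigO t0 (\<lambda>t. norm (A (x t) - b)) (\<lambda>t. 1 / t powr p + 1 / t powr (k / 2)) \<and>
    (kkt 0 (xs, ls) \<longrightarrow> m \<le> k / 2 \<longrightarrow> m \<le> k + 2 * q + s \<longrightarrow>
      le_bigO t0 (\<lambda>t. reg 0 (x t) ls - reg 0 xs ls) (\<lambda>t. 1 / t powr p + 1 / t powr m) \<and>
      le_bigO t0 (\<lambda>t. \<bar>f (x t) - f xs\<bar>) (\<lambda>t. 1 / t powr p + 1 / t powr m)) \<and>
    (0 < k \<longrightarrow> ((\<lambda>t. (x t, l t) - z t) \<longlongrightarrow> 0) at_top)"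
proof -
  obtain C T where T: "T > t0" and C: "C > 0" and T1: "\<And>t. t \<ge> T \<Longrightarrow> 1 \<le> t"
    and b1: "\<And>t. t \<ge> T \<Longrightarrow> (norm (x t - fst (z t)))\<^sup>2 \<le> C * (1 / t powr k)"
    and b2: "\<And>t. t \<ge> T \<Longrightarrow> (norm (l t - snd (z t)))\<^sup>2 \<le> C * (1 / t powr k)"
    and b3: "\<And>t. t \<ge> T \<Longrightarrow> (norm (x' t))\<^sup>2 \<le> C * (1 / t powr (k + 2 * q))"
    and b4: "\<And>t. t \<ge> T \<Longrightarrow> gap t \<le> C * (1 / t powr (k + 2 * q + s))"
    using rates[OF sp r k] by metis
  have c1: "le_bigO t0 (\<lambda>t. (norm (x t - fst (z t)))\<^sup>2) (\<lambda>t. 1 / t powr k)"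
    "le_bigO t0 (\<lambda>t. (norm (l t - snd (z t)))\<^sup>2) (\<lambda>t. 1 / t powr k)"
    "le_bigO t0 (\<lambda>t. (norm (x' t))\<^sup>2) (\<lambda>t. 1 / t powr (k + 2 * q))"
    "le_bigO t0 gap (\<lambda>t. 1 / t powr (k + 2 * q + s))"
    by (rule le_bigOI[of T _ C]; use b1 b2 b3 b4 in simp)+
  define F where "F = onorm A * sqrt C + c * R"
  have sqrt_bound: "v \<le> sqrt C * (1 / t powr (k / 2))" if "v\<^sup>2 \<le> C * (1 / t powr k)" "t > 0" for v t
  proof (rule power2_le_imp_le)
    have "(t powr (k / 2))\<^sup>2 = t powr k" by (simp add: power2_eq_square flip: powr_add)
    then show "v\<^sup>2 \<le> (sqrt C * (1 / t powr (k / 2)))\<^sup>2"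
      using that C by (simp add: power_mult_distrib power_divide)
  qed (use C in simp)
  have feas: "norm (A (x t) - b) \<le> F * (1 / t powr p + 1 / t powr (k / 2))" if "t \<ge> T" for t
  proof -
    have tp: "t \<ge> t0" "t > 0" using that T t0 by auto
    have nn: "0 \<le> onorm A * sqrt C" "0 \<le> c * R" using onorm_pos_le[OF A] C c R_nonneg by auto
    have "norm (A (x t) - b) \<le> onorm A * (sqrt C * (1 / t powr (k / 2))) + ep t * R"
      using feasibility_le[OF tp(1)] mult_left_mono[OF sqrt_bound[OF b1[OF that] tp(2)] onorm_pos_le[OF A]]
      by linarith
    also have "\<dots> = (onorm A * sqrt C) * (1 / t powr (k / 2)) + (c * R) * (1 / t powr p)"
      by (simp add: ep_def)
    also have "\<dots> \<le> F * (1 / t powr (k / 2)) + F * (1 / t powr p)"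
      unfolding F_def using nn by (intro add_mono mult_right_mono) auto
    finally show ?thesis by (simp add: distrib_left)
  qed
  then have c2: "le_bigO t0 (\<lambda>t. norm (A (x t) - b)) (\<lambda>t. 1 / t powr p + 1 / t powr (k / 2))"
    by (intro le_bigOI[of T _ F]) (auto intro!: add_nonneg_nonneg)
  have "0 \<le> F" using onorm_pos_le[OF A] C c R_nonneg by (simp add: F_def)
  have total: "gap t + ep t / 2 * (norm xs)\<^sup>2 + K * norm (A (x t) - b)
      \<le> (C + c / 2 * (norm xs)\<^sup>2 + K * F) * (1 / t powr p + 1 / t powr m)"
    if "t \<ge> T" "m \<le> k / 2" "m \<le> k + 2 * q + s" "0 \<le> K" for t m K xs
  proof -
    have pw: "1 / t powr j \<le> 1 / t powr m" if "m \<le> j" for j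
      using T1[OF \<open>t \<ge> T\<close>] that by (intro divide_left_mono powr_mono) auto
    define h where "h = 1 / t powr p + 1 / t powr m"
    have h: "1 / t powr p \<le> h" "1 / t powr m \<le> h" by (simp_all add: h_def)
    have "gap t \<le> C * h"
      using b4[OF that(1)] pw[OF that(3)] h(2) C
      by (meson mult_left_mono order_trans less_imp_le)
    moreover have "ep t / 2 * (norm xs)\<^sup>2 \<le> c / 2 * (norm xs)\<^sup>2 * h"
    proof -
      have "ep t / 2 * (norm xs)\<^sup>2 = c / 2 * (norm xs)\<^sup>2 * (1 / t powr p)" by (simp add: ep_def)
      then show ?thesis using h(1) c by (simp only:) (intro mult_left_mono, auto)
    qed
    moreover have "K * norm (A (x t) - b) \<le> K * (F * h)"
    proof (rule mult_left_mono)
      have "norm (A (x t) - b) \<le> F * (1 / t powr p + 1 / t powr (k / 2))" by (rule feas[OF that(1)])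
      also have "\<dots> \<le> F * h" using pw[OF that(2)] \<open>0 \<le> F\<close> by (intro mult_left_mono) (auto simp: h_def)
      finally show "norm (A (x t) - b) \<le> F * h" .
    qed (rule that)
    ultimately show ?thesis unfolding h_def[symmetric] by (simp add: distrib_right)
  qed
  have c3: "le_bigO t0 (\<lambda>t. reg 0 (x t) ls - reg 0 xs ls) (\<lambda>t. 1 / t powr p + 1 / t powr m)"
    if "kkt 0 (xs, ls)" "m \<le> k / 2" "m \<le> k + 2 * q + s"
  proof (rule le_bigOI)
    fix t assume "T \<le> t"
    then show "reg 0 (x t) ls - reg 0 xs ls
        \<le> (C + c / 2 * (norm xs)\<^sup>2 + (norm ls + R) * F) * (1 / t powr p + 1 / t powr m)"
      using objective_le(1)[OF _ that(1), of t] total[OF _ that(2,3), of t "norm ls + R" xs] T R_nonneg by fastforce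
  qed (intro add_nonneg_nonneg; simp)
  have c4: "le_bigO t0 (\<lambda>t. \<bar>f (x t) - f xs\<bar>) (\<lambda>t. 1 / t powr p + 1 / t powr m)"
    if "kkt 0 (xs, ls)" "m \<le> k / 2" "m \<le> k + 2 * q + s"
  proof (rule le_bigOI)
    fix t assume "T \<le> t"
    then show "\<bar>f (x t) - f xs\<bar>
        \<le> (C + c / 2 * (norm xs)\<^sup>2 + (2 * norm ls + R) * F) * (1 / t powr p + 1 / t powr m)"
      using objective_le(2)[OF _ that(1), of t] total[OF _ that(2,3), of t "2 * norm ls + R" xs] T R_nonneg by fastforce
  qed (intro add_nonneg_nonneg; simp)
  have c5: "((\<lambda>t. (x t, l t) - z t) \<longlongrightarrow> 0) at_top" if "k > 0"
  proof -
    have "((\<lambda>t. t powr (- (k / 2))) \<longlongrightarrow> 0) at_top"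
      using tendsto_neg_powr[OF _ filterlim_ident] that by simp
    then have "((\<lambda>t. sqrt C * (1 / t powr (k / 2))) \<longlongrightarrow> 0) at_top"
      using tendsto_mult_left[of "\<lambda>t. t powr (- (k / 2))" 0 at_top "sqrt C"] by (simp add: powr_minus_divide)
    moreover have "\<forall>\<^sub>F t in at_top. norm (x t - fst (z t)) \<le> sqrt C * (1 / t powr (k / 2))"
      "\<forall>\<^sub>F t in at_top. norm (l t - snd (z t)) \<le> sqrt C * (1 / t powr (k / 2))"
      using b1 b2 sqrt_bound T t0 unfolding eventually_at_top_linorder
      by (meson less_le_trans less_trans)+
    ultimately have "((\<lambda>t. x t - fst (z t)) \<longlongrightarrow> 0) at_top" "((\<lambda>t. l t - snd (z t)) \<longlongrightarrow> 0) at_top"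
      by (auto intro: Lim_null_comparison)
    then have "((\<lambda>t. (x t - fst (z t), l t - snd (z t))) \<longlongrightarrow> (0, 0)) at_top" by (rule tendsto_Pair)
    then show ?thesis by (simp add: minus_prod_def zero_prod_def)
  qed
  show ?thesis by (intro conjI impI c1 c2 c3 c4 c5)
qed

end

section \<open>The two parameter regimes\<close>

theorem theorem3p1:
  fixes f :: "'a::{real_inner,complete_space} \<Rightarrow> real"
    and gradf :: "'a \<Rightarrow> 'a"
    and A :: "'a \<Rightarrow> 'b::{real_inner,complete_space}"
    and b :: 'b
    and t0 \<alpha> \<theta> q p c s :: real
    and x x' x'' :: "real \<Rightarrow> 'a"
    and l l' :: "real \<Rightarrow> 'b"
    and xs :: 'a and ls :: 'b
    and xt :: "real \<Rightarrow> 'a" and lt :: "real \<Rightarrow> 'b"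
  defines "L \<equiv> lagrangian f A b"
    and "Lt \<equiv> reg_lagrangian f A b c p"
  assumes convex: "convex_on UNIV f"
    and grad: "\<And>y. GDERIV f y :> gradf y"
    and grad_cont: "continuous_on UNIV gradf"
    and A: "bounded_linear A"
    and Omega: "saddle_points L \<noteq> {}"
    and params: "t0 > 0" "\<alpha> > 0" "\<theta> > 1 / \<alpha>" "0 \<le> q" "q < 1" "0 < p" "p < 1 - q" "c > 0"
    and s: "p - q - 1 < s" "s < 1 - 3 * q"
    and sol: "primal_dual_solution gradf A b t0 \<alpha> \<theta> q p s c x x' x'' l l'"
    and min_norm: "(xs, ls) = min_norm_element (saddle_points L)"
    and path: "\<And>t. t \<ge> t0 \<Longrightarrow> (xt t, lt t) = the_saddle_point (Lt t)"
  shows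
    "((\<lambda>t. norm ((x t, l t) - (xs, ls))) \<longlongrightarrow> 0) at_top
     \<and>
     (p - q - 1 < s \<and> s < (p - 3 * q - 1) / 2 \<longrightarrow>
        le_bigO t0 (\<lambda>t. (norm (x t - xt t))\<^sup>2) (\<lambda>t. 1 / t powr (2 * (1 + s + q - p))) \<and>
        le_bigO t0 (\<lambda>t. (norm (l t - lt t))\<^sup>2) (\<lambda>t. 1 / t powr (2 * (1 + s + q - p))) \<and>
        le_bigO t0 (\<lambda>t. (norm (x' t))\<^sup>2) (\<lambda>t. 1 / t powr (2 * (1 + s + 2 * q - p))) \<and>
        le_bigO t0 (\<lambda>t. norm (A (x t) - b))
          (\<lambda>t. 1 / t powr p + 1 / t powr (1 + s + q - p)) \<and>
        ((2 * p - 2 - 4 * q) / 3 < s \<and> s < (p - 3 * q - 1) / 2 \<longrightarrow>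
           le_bigO t0 (\<lambda>t. Lt t (x t) (lt t) - Lt t (xt t) (lt t))
             (\<lambda>t. 1 / t powr (4 * q + 3 * s - 2 * p + 2)) \<and>
           le_bigO t0 (\<lambda>t. L (x t) ls - L xs ls)
             (\<lambda>t. 1 / t powr p + 1 / t powr (4 * q + 3 * s - 2 * p + 2)) \<and>
           le_bigO t0 (\<lambda>t. \<bar>f (x t) - f xs\<bar>)
             (\<lambda>t. 1 / t powr p + 1 / t powr (4 * q + 3 * s - 2 * p + 2))))
     \<and>
     ((p - 3 * q - 1) / 2 \<le> s \<and> s < 1 - 3 * q \<longrightarrow>
        (let r = max q (p - q - s) in
           le_bigO t0 (\<lambda>t. Lt t (x t) (lt t) - Lt t (xt t) (lt t)) (\<lambda>t. 1 / t powr (1 - r)) \<and>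
           le_bigO t0 (\<lambda>t. (norm (x t - xt t))\<^sup>2) (\<lambda>t. 1 / t powr (1 - 2 * q - s - r)) \<and>
           le_bigO t0 (\<lambda>t. (norm (l t - lt t))\<^sup>2) (\<lambda>t. 1 / t powr (1 - 2 * q - s - r)) \<and>
           le_bigO t0 (\<lambda>t. (norm (x' t))\<^sup>2) (\<lambda>t. 1 / t powr (1 - s - r)) \<and>
           le_bigO t0 (\<lambda>t. L (x t) ls - L xs ls)
             (\<lambda>t. 1 / t powr p + 1 / t powr ((1 - 2 * q - s - r) / 2)) \<and>
           le_bigO t0 (\<lambda>t. \<bar>f (x t) - f xs\<bar>)
             (\<lambda>t. 1 / t powr p + 1 / t powr ((1 - 2 * q - s - r) / 2)) \<and>
           le_bigO t0 (\<lambda>t. norm (A (x t) - b))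
             (\<lambda>t. 1 / t powr p + 1 / t powr ((1 - 2 * q - s - r) / 2))))"
proof -
  interpret S: convex_saddle f gradf A b
    using convex grad grad_cont A by (intro convex_saddle.intro)
  have L_eq: "L = S.reg 0" by (simp add: L_def lagrangian_def S.reg_def fun_eq_iff)
  have Lt_eq: "Lt = (\<lambda>t. S.reg (c / t powr p))"
    by (simp add: Lt_def reg_lagrangian_def lagrangian_def S.reg_def fun_eq_iff)
  have \<Omega>: "saddle_points L = {w. S.kkt 0 w}"
    using S.saddle_points_reg_iff[of 0] by (auto simp: L_eq)
  obtain w0 where w0: "S.kkt 0 w0" using Omega \<Omega> by auto
  define Z where "Z = (\<lambda>t. (xt t, lt t))"
  have pos: "0 < c / t powr p" if "t0 \<le> t" for t using params that by simp
  have Z: "S.kkt (c / t powr p) (Z t)" if "t0 \<le> t" for t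
    using path[OF that] S.the_saddle_point_reg[OF pos[OF that]] by (simp add: Z_def Lt_eq)
  \<comment> \<open>Any solution bounds the whole path in norm, so \<open>norm w0\<close> serves as
    \<open>R\<close>.\<close>
  interpret F: primal_dual_flow f gradf A b t0 \<alpha> \<theta> q p c s x x' x'' l l' Z "norm w0"
    using params sol Z S.kkt_norm_le[OF Z w0 pos]
    by (intro primal_dual_flow.intro primal_dual_flow_axioms.intro S.convex_saddle_axioms) auto
  have "((\<lambda>t. c / t powr p) \<longlongrightarrow> 0) at_top"
    using tendsto_mult_right_zero[OF tendsto_neg_powr[OF _ filterlim_ident, of "- p"], of c] params
    by (simp add: powr_minus_divide)
  then have Zlim: "(Z \<longlongrightarrow> (xs, ls)) at_top" and opt: "S.kkt 0 (xs, ls)"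
    using S.kkt_path_converges[of t0 "\<lambda>t. c / t powr p" Z w0] Z pos w0 F.ep_antimono
    by (simp_all add: min_norm \<Omega> F.ep_def)
  have gap_eq: "F.gap = (\<lambda>t. Lt t (x t) (lt t) - Lt t (xt t) (lt t))"
    by (rule ext) (unfold F.gap_def F.ep_def Lt_eq, simp add: Z_def)
  have sp: "p - 2 < s" using s params by linarith
  have lim: "((\<lambda>t. norm ((x t, l t) - (xs, ls))) \<longlongrightarrow> 0) at_top"
    if "((\<lambda>t. (x t, l t) - Z t) \<longlongrightarrow> 0) at_top"
  proof -
    have "((\<lambda>t. ((x t, l t) - Z t) + Z t) \<longlongrightarrow> 0 + (xs, ls)) at_top" by (intro tendsto_add that Zlim)
    then have "((\<lambda>t. (x t, l t)) \<longlongrightarrow> (xs, ls)) at_top" by simp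
    then show ?thesis by (intro tendsto_norm_zero LIM_zero)
  qed
  show ?thesis
  proof (cases "s < (p - 3 * q - 1) / 2")
    case True
    \<comment> \<open>With \<open>r = p - q - s\<close> this is the largest \<open>k\<close> that
      the first drift condition allows. It is positive by the lower bound on \<open>s\<close>, and
      the other two conditions follow from \<open>2 * q + s < 0\<close>, which holds in this
      regime.\<close>
    define k where "k = 2 * (1 + s + q - p)"
    have r: "q \<le> p - q - s" "p - q - s \<le> p - q - s" "p - q - s < 1"
      and k: "p - q - s - 2 \<le> - k - (p - q - s)" "q - 2 \<le> - k - (p - q - s)"
        "3 * q + s + p - 2 \<le> - k - (p - q - s)" "0 < k"
      using s params True by (auto simp: k_def)
    note O = F.bigO_rates[OF sp r k(1-3), of xs ls]
    have e: "2 * (1 + s + 2 * q - p) = k + 2 * q" "1 + s + q - p = k / 2"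
      "4 * q + 3 * s - 2 * p + 2 = k + 2 * q + s" by (simp_all add: k_def)
    \<comment> \<open>The regime is exactly the one in which the gap is slower than the
      infeasibility bound.\<close>
    have m: "k + 2 * q + s \<le> k / 2" using True by (simp add: k_def)
    show ?thesis
      using lim O[of "k + 2 * q + s"] k(4) opt m True
      unfolding e k_def[symmetric] gap_eq L_eq by (simp add: Z_def)
  next
    case False
    define r where "r = max q (p - q - s)"
    \<comment> \<open>This choice gives the gap the exponent \<open>1 - r\<close>. The lower bound
      on \<open>s\<close> is the first drift condition for \<open>k + r = 1 - 2 * q - s\<close>.
      Positivity of \<open>k\<close> is \<open>s < 1 - 3 * q\<close> if \<open>r = q\<close>, and
      \<open>p < 1 - q\<close> if \<open>r = p - q - s\<close>.\<close>
    define k where "k = 1 - 2 * q - s - r"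
    have r: "q \<le> r" "p - q - s \<le> r" "r < 1"
      and k: "p - q - s - 2 \<le> - k - r" "q - 2 \<le> - k - r" "3 * q + s + p - 2 \<le> - k - r" "0 < k"
      and m: "k / 2 \<le> k + 2 * q + s"
      using s params False by (auto simp: k_def r_def max_def)
    note O = F.bigO_rates[OF sp r k(1-3), of xs ls]
    have e: "1 - s - r = k + 2 * q" "1 - r = k + 2 * q + s" by (simp_all add: k_def)
    show ?thesis
      using lim O[of "k / 2"] k(4) opt m False
      unfolding Let_def r_def[symmetric] e k_def[symmetric] gap_eq L_eq by (simp add: Z_def)
  qed
qed

end
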